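(* Let $f$ be a twice continuously differentiable convex function, $\mathcal G$ be an affine mapping, and $\bar x$ be a minimizer of the problem $\min\{f(x):\mathcal G(x)\in\mathcal K\}$ with $\Lambda(\bar x)\neq\emptyset$. Let $(\bar y,\bar z)\in\Lambda(\bar x)$. Then $G^{-1}$ is isolated calm at the origin for $(\bar x,\bar y,\bar z)$ if and only if the second-order sufficient optimality condition holds at $\bar x$ and the SRCQ holds at $\bar x$ for $(\bar y,\bar z)$.
   Context: $\mathcal X,\mathcal Z$ are finite-dimensional real Euclidean spaces; $\mathbb S^p$ is the space of $p\times p$ real symmetric matrices with trace inner product, $\mathbb S^p_+$ its cone of positive semi-definite matrices, $\mathbb S^p_-=-\mathbb S^p_+$; $\mathcal Y:=\mathbb S^p\times\mathcal Z$. $f:\mathcal X\to\mathbb R$, $\mathcal G=(\phi,\psi):\mathcal X\to\mathcal Y$ with $\phi:\mathcal X\to\mathbb S^p$, $\psi:\mathcal X\to\mathcal Z$; $\mathcal K=\mathbb S^p_-\times\mathcal P$ with $\mathcal P\subset\mathcal Z$ a nonempty convex polyhedral set. $N_{\mathcal K}$, $T_{\mathcal K}$ denote normal and tangent cones of convex analysis, $\Pi_{\mathcal K}$ the metric projection, $w^\perp=\{v:\langle v,w\rangle=0\}$, and $S^\dagger$ the Moore–Penrose pseudo-inverse. Lagrangian: $\mathcal L(x;y,z)=f(x)+\langle y,\phi(x)\rangle+\langle z,\psi(x)\rangle$; $\nabla_x\mathcal L$, $\nabla^2_{xx}\mathcal L$ are its first and second derivatives in $x$. $\Lambda(\bar x)$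 is the set of $(y,z)\in\mathbb S^p\times\mathcal Z$ with $\nabla_x\mathcal L(\bar x;y,z)=0$ and $(y,z)\in N_{\mathcal K}(\mathcal G(\bar x))$. SRCQ (strict Robinson constraint qualification) at $\bar x$ for $(\bar y,\bar z)\in\Lambda(\bar x)$: $\mathrm D\mathcal G(\bar x)\mathcal X+T_{\mathcal K}(\mathcal G(\bar x))\cap(\bar y,\bar z)^\perp=\mathcal Y$. Critical cone: $\mathcal C(\bar x)=\{d\in\mathcal X:\mathrm D\mathcal G(\bar x)d\in T_{\mathcal K}(\mathcal G(\bar x)),\ \mathrm Df(\bar x)d\le0\}$. Second-order sufficient optimality condition at $\bar x$: $$\sup_{(y,z)\in\Lambda(\bar x)}\big\{\langle d,\nabla^2_{xx}\mathcal L(\bar x;y,z)d\rangle+2\langle y,\mathrm D\phi(\bar x)d\,[-\phi(\bar x)]^\dagger\,\mathrm D\phi(\bar x)d\rangle\big\}>0\quad\forall\,0\ne d\in\mathcal C(\bar x).$$ KKT mapping $G:\mathcal X\times\mathbb S^p\times\mathcal Z\to\mathcal X\times\mathbb S^p\times\mathcal Z$: $G(x,y,z)=\big(\nabla_x\mathcal L(x;y,z),\ -\mathcal G(x)+\Pi_{\mathcal K}(\mathcal G(x)+(y,z))\big)$; $G^{-1}$ is its set-valued inverse. A set-valued mapping $F$ is isolated calm at $a$ for $b\in F(a)$ if there are $\kappa_0>0$ and neighborhoods $V$ of $a$, $W$ of $b$ such that $F(a')\cap W\subseteq\{b'':\|b''-b\|\le\kappa_0\|a'-a\|\}$ for all $a'\in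 V$. *)

theory Defs
  imports "HOL-Analysis.Analysis"
begin

section \<open>Smoothness and affinity\<close>

definition gradient :: "('a::real_inner \<Rightarrow> real) \<Rightarrow> 'a \<Rightarrow> 'a" where
  "gradient f x = (THE g. GDERIV f x :> g)"

definition twice_continuously_differentiable :: "('a::real_normed_vector \<Rightarrow> real) \<Rightarrow> bool" where
  "twice_continuously_differentiable f \<longleftrightarrow>
     (\<exists>(f' :: 'a \<Rightarrow> 'a \<Rightarrow>\<^sub>L real) (f'' :: 'a \<Rightarrow> 'a \<Rightarrow>\<^sub>L ('a \<Rightarrow>\<^sub>L real)).
        (\<forall>x. (f has_derivative blinfun_apply (f' x)) (at x)) \<and>
        (\<forall>x. (f' has_derivative blinfun_apply (f'' x)) (at x)) \<and>
        continuous_on UNIV f'')"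

definition affine_mapping :: "('a::real_vector \<Rightarrow> 'b::real_vector) \<Rightarrow> bool" where
  "affine_mapping F \<longleftrightarrow> (\<exists>A c. linear A \<and> F = (\<lambda>x. A x + c))"


section \<open>Symmetric matrices\<close>

text \<open>The space of symmetric matrices is the subspace \<open>sym_mats\<close> of \<^typ>\<open>real^'p^'p\<close>; the inner
  product of the ambient type restricts to the trace inner product on it.\<close>

definition sym_mats :: "(real^'p^'p) set" where
  "sym_mats = {A. transpose A = A}"

definition psd_mats :: "(real^'p^'p) set" where
  "psd_mats = {A \<in> sym_mats. \<forall>v. v \<bullet> (A *v v) \<ge> 0}"

definition nsd_mats :: "(real^'p^'p) set" where
  "nsd_mats = uminus ` psd_mats"

text \<open>The Moore--Penrose pseudo-inverse, as the unique solution of the four Penrose equations.\<close>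

definition pinv :: "real^'n^'m \<Rightarrow> real^'m^'n" where
  "pinv A = (THE B. A ** B ** A = A \<and> B ** A ** B = B \<and>
                    transpose (A ** B) = A ** B \<and> transpose (B ** A) = B ** A)"


section \<open>Cones of convex analysis\<close>

definition normal_cone :: "'a::euclidean_space set \<Rightarrow> 'a \<Rightarrow> 'a set" where
  "normal_cone K a = (if a \<in> K then {v. \<forall>k\<in>K. v \<bullet> (k - a) \<le> 0} else {})"

text \<open>For convex sets: the closure of the cone of feasible directions.\<close>

definition tangent_cone :: "'a::euclidean_space set \<Rightarrow> 'a \<Rightarrow> 'a set" where
  "tangent_cone K a = (if a \<in> K then closure (cone hull ((\<lambda>k. k - a) ` K)) else {})"


section \<open>Isolated calmness\<close>

definition isolated_calm ::
    "('a::real_normed_vector \<Rightarrow> 'b::real_normed_vector set) \<Rightarrow> 'a \<Rightarrow> 'b \<Rightarrow> bool" where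
  "isolated_calm F a b \<longleftrightarrow> b \<in> F a \<and>
     (\<exists>\<kappa>>0. \<exists>V W. open V \<and> a \<in> V \<and> open W \<and> b \<in> W \<and>
        (\<forall>a'\<in>V. F a' \<inter> W \<subseteq> {b'. norm (b' - b) \<le> \<kappa> * norm (a' - a)}))"


section \<open>The conic problem\<close>

definition constr_map ::
    "('x::euclidean_space \<Rightarrow> real^'p^'p) \<Rightarrow> ('x \<Rightarrow> 'z::euclidean_space) \<Rightarrow> 'x \<Rightarrow> (real^'p^'p) \<times> 'z" where
  "constr_map \<phi> \<psi> x = (\<phi> x, \<psi> x)"

definition constr_set :: "'z::euclidean_space set \<Rightarrow> ((real^'p^'p) \<times> 'z) set" where
  "constr_set P = nsd_mats \<times> P"

definition lagrangian ::
    "('x::euclidean_space \<Rightarrow> real) \<Rightarrow> ('x \<Rightarrow> real^'p^'p) \<Rightarrow> ('x \<Rightarrow> 'z::euclidean_space) \<Rightarrow>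
     'x \<Rightarrow> real^'p^'p \<Rightarrow> 'z \<Rightarrow> real" where
  "lagrangian f \<phi> \<psi> x y z = f x + y \<bullet> \<phi> x + z \<bullet> \<psi> x"

definition grad_lagrangian ::
    "('x::euclidean_space \<Rightarrow> real) \<Rightarrow> ('x \<Rightarrow> real^'p^'p) \<Rightarrow> ('x \<Rightarrow> 'z::euclidean_space) \<Rightarrow>
     'x \<Rightarrow> real^'p^'p \<Rightarrow> 'z \<Rightarrow> 'x" where
  "grad_lagrangian f \<phi> \<psi> x y z = gradient (\<lambda>x. lagrangian f \<phi> \<psi> x y z) x"

definition hess_lagrangian ::
    "('x::euclidean_space \<Rightarrow> real) \<Rightarrow> ('x \<Rightarrow> real^'p^'p) \<Rightarrow> ('x \<Rightarrow> 'z::euclidean_space) \<Rightarrow>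
     'x \<Rightarrow> real^'p^'p \<Rightarrow> 'z \<Rightarrow> 'x \<Rightarrow> 'x" where
  "hess_lagrangian f \<phi> \<psi> x y z = frechet_derivative (\<lambda>x. grad_lagrangian f \<phi> \<psi> x y z) (at x)"

text \<open>Here and in the inverse KKT mapping below, matrix multipliers are confined to \<open>sym_mats\<close>: in the
  ambient matrix type the normal cone would also contain all skew-symmetric directions.\<close>

definition multipliers ::
    "('x::euclidean_space \<Rightarrow> real) \<Rightarrow> ('x \<Rightarrow> real^'p^'p) \<Rightarrow> ('x \<Rightarrow> 'z::euclidean_space) \<Rightarrow>
     'z set \<Rightarrow> 'x \<Rightarrow> ((real^'p^'p) \<times> 'z) set" where
  "multipliers f \<phi> \<psi> P x =
     {(y, z) \<in> sym_mats \<times> UNIV.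
        grad_lagrangian f \<phi> \<psi> x y z = 0 \<and> (y, z) \<in> normal_cone (constr_set P) (constr_map \<phi> \<psi> x)}"

definition SRCQ ::
    "('x::euclidean_space \<Rightarrow> real^'p^'p) \<Rightarrow> ('x \<Rightarrow> 'z::euclidean_space) \<Rightarrow> 'z set \<Rightarrow>
     'x \<Rightarrow> real^'p^'p \<Rightarrow> 'z \<Rightarrow> bool" where
  "SRCQ \<phi> \<psi> P x y z \<longleftrightarrow>
     range (frechet_derivative (constr_map \<phi> \<psi>) (at x)) +
       (tangent_cone (constr_set P) (constr_map \<phi> \<psi> x) \<inter> orthogonal_comp {(y, z)})
     = sym_mats \<times> UNIV"

definition critical_cone ::
    "('x::euclidean_space \<Rightarrow> real) \<Rightarrow> ('x \<Rightarrow> real^'p^'p) \<Rightarrow> ('x \<Rightarrow> 'z::euclidean_space) \<Rightarrow>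
     'z set \<Rightarrow> 'x \<Rightarrow> 'x set" where
  "critical_cone f \<phi> \<psi> P x =
     {d. frechet_derivative (constr_map \<phi> \<psi>) (at x) d
           \<in> tangent_cone (constr_set P) (constr_map \<phi> \<psi> x) \<and>
         frechet_derivative f (at x) d \<le> 0}"

text \<open>The supremum is taken in the extended reals, since it may be infinite.\<close>

definition SOSC ::
    "('x::euclidean_space \<Rightarrow> real) \<Rightarrow> ('x \<Rightarrow> real^'p^'p) \<Rightarrow> ('x \<Rightarrow> 'z::euclidean_space) \<Rightarrow>
     'z set \<Rightarrow> 'x \<Rightarrow> bool" where
  "SOSC f \<phi> \<psi> P x \<longleftrightarrow>
     (\<forall>d \<in> critical_cone f \<phi> \<psi> P x. d \<noteq> 0 \<longrightarrow>
        (SUP (y, z) \<in> multipliers f \<phi> \<psi> P x.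
           ereal (d \<bullet> hess_lagrangian f \<phi> \<psi> x y z d +
             2 * (y \<bullet> (frechet_derivative \<phi> (at x) d ** pinv (- \<phi> x) ** frechet_derivative \<phi> (at x) d))))
        > 0)"

definition KKT_map ::
    "('x::euclidean_space \<Rightarrow> real) \<Rightarrow> ('x \<Rightarrow> real^'p^'p) \<Rightarrow> ('x \<Rightarrow> 'z::euclidean_space) \<Rightarrow>
     'z set \<Rightarrow> 'x \<times> (real^'p^'p) \<times> 'z \<Rightarrow> 'x \<times> (real^'p^'p) \<times> 'z" where
  "KKT_map f \<phi> \<psi> P = (\<lambda>(x, y, z).
     (grad_lagrangian f \<phi> \<psi> x y z,
      - constr_map \<phi> \<psi> x + closest_point (constr_set P) (constr_map \<phi> \<psi> x + (y, z))))"

text \<open>When \<open>\<phi>\<close> takes symmetric values, the KKT mapping sends \<open>UNIV \<times> sym_mats \<times> UNIV\<close> into itself, so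
  its inverse is empty off that subspace and ambient neighborhoods express the relative ones.\<close>

definition KKT_inverse ::
    "('x::euclidean_space \<Rightarrow> real) \<Rightarrow> ('x \<Rightarrow> real^'p^'p) \<Rightarrow> ('x \<Rightarrow> 'z::euclidean_space) \<Rightarrow>
     'z set \<Rightarrow> 'x \<times> (real^'p^'p) \<times> 'z \<Rightarrow> ('x \<times> (real^'p^'p) \<times> 'z) set" where
  "KKT_inverse f \<phi> \<psi> P w = {u \<in> UNIV \<times> sym_mats \<times> UNIV. KKT_map f \<phi> \<psi> P u = w}"

end

theory Submission
  imports Defs
begin

text \<open>
  Write \<open>q\<close> for the affine constraint map, \<open>L\<close> for its linear part, \<open>K\<close> for the constraint set, \<open>b = (Y, z)\<close>
  for the given multiplier, and \<open>A\<close> for the matrix component of \<open>q x\<close>. Since \<open>q\<close> is affine, the Hessian of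
  the Lagrangian is the second derivative \<open>D\<close> of \<open>f\<close>, whatever the multiplier. Both implications analyse
  the directions along which the residual of the KKT system vanishes to first order.

  Sufficiency. If calmness fails, normalising a sequence of violating points gives a direction
  \<open>(d, w) \<noteq> 0\<close> with \<open>D d + adjoint L w = 0\<close> and \<open>(L d, w)\<close> tangent to the graph of the normal cone mapping of
  \<open>K\<close> at \<open>(q x, b)\<close> (\<open>not_isolated_calm_tangent\<close>). Such a \<open>d\<close> is critical, and pairing the equation with
  \<open>d\<close> gives \<open>d \<bullet> D d + L d \<bullet> w = 0\<close>. The polyhedral part of \<open>L d \<bullet> w\<close> is nonnegative by monotonicity. The
  matrix part \<open>(H, W)\<close> contributes exactly the curvature term \<open>2 * (Y \<bullet> (H ** pinv (- A) ** H))\<close>, because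
  nearby pairs satisfy \<open>An ** Yn = 0\<close> and this equation can be expanded to second order
  (\<open>normal_graph_tangent_curvature\<close>). So the second-order form at \<open>b\<close> is nonpositive at \<open>d\<close>. The strict
  constraint qualification makes \<open>b\<close> the only multiplier, so the second-order condition forces \<open>d = 0\<close>.
  Then \<open>adjoint L w = 0\<close> and \<open>w\<close> is polar to the critical directions, and the constraint
  qualification in its dual form (\<open>SRCQ_iff\<close>) gives \<open>w = 0\<close>, a contradiction.

  Necessity of the constraint qualification. If it fails, the dual form provides \<open>w \<noteq> 0\<close> with
  \<open>adjoint L w = 0\<close> in the polar of the critical directions, and this polar is the closed cone generated
  by the differences \<open>n - b\<close> of normals
  (\<open>polar_critical_cone_subset_tangent_normal_cone\<close>). Changing the multiplier from \<open>b\<close> towards a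
  normal \<open>n\<close> for which \<open>n - b\<close> is nearly parallel to \<open>w\<close>, with \<open>x\<close> fixed, produces a residual that is small
  relative to the displacement.

  Necessity of the second-order condition. Here convexity of \<open>f\<close> enters. If the second-order form at \<open>b\<close>
  is nonpositive at a critical \<open>d \<noteq> 0\<close>, both its terms vanish, being nonnegative. Vanishing of the first
  gives \<open>D d = 0\<close> (\<open>convex_hessian_kernel\<close>), and vanishing of the second gives \<open>Y ** H = 0\<close>
  (\<open>flat_critical_direction\<close>). Hence \<open>b\<close> remains normal to \<open>K\<close> at points within \<open>o(t)\<close> of
  \<open>q (x + t *\<^sub>R d)\<close> (\<open>flat_direction_feasible\<close>), and the residual at \<open>(x + t *\<^sub>R d, b)\<close> is \<open>o(t)\<close>.

  The projection onto \<open>K\<close> is never differentiated: only its characterisation by normals and its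
  nonexpansiveness are used. The matrix arguments rest on the spectral decomposition of symmetric
  matrices and on the fact that positive semidefinite matrices with zero inner product have zero product.
\<close>

section \<open>Symmetric and positive semidefinite matrices\<close>

text \<open>Near \<open>s = 0\<close> the linear term dominates and changes sign. This is how a nonnegative quadratic
  form is shown to have a vanishing first variation at each of its zeros.\<close>

lemma linear_coefficient_eq_0:
  fixes a b :: real
  assumes "\<And>s. 0 \<le> s * a + s\<^sup>2 * b"
  shows "a = 0"
proof (rule ccontr)
  assume "a \<noteq> 0"
  \<comment> \<open>At \<open>s = - (a / c)\<close> with \<open>c > max 0 b\<close> the value is \<open>a\<^sup>2 / c * (b / c - 1)\<close>, which is negative.\<close>
  define c where "c = \<bar>b\<bar> + 1"
  have c: "c > 0" "b < c" by (auto simp: c_def)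
  have "(- (a / c)) * a + (- (a / c))\<^sup>2 * b = a\<^sup>2 / c * (b / c - 1)"
    using c by (simp add: power2_eq_square field_simps)
  also have "\<dots> < 0"
    using \<open>a \<noteq> 0\<close> c by (intro mult_pos_neg) auto
  finally show False
    using assms[of "- (a / c)"] by linarith
qed

lemma bounded_bilinear_matrix_mult:
  "bounded_bilinear ((**) :: real^'n^'m \<Rightarrow> real^'k^'n \<Rightarrow> real^'k^'m)"
proof -
  have "bilinear ((**) :: real^'n^'m \<Rightarrow> real^'k^'n \<Rightarrow> real^'k^'m)"
    unfolding bilinear_def
    by (auto intro!: linearI simp: matrix_matrix_mult_def vec_eq_iff sum.distrib algebra_simps
        sum_distrib_left)
  then show ?thesis
    by (simp add: bilinear_conv_bounded_bilinear)
qed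

interpretation mat_mult: bounded_bilinear "(**) :: real^'n^'m \<Rightarrow> real^'k^'n \<Rightarrow> real^'k^'m"
  by (rule bounded_bilinear_matrix_mult)

lemma linear_transpose: "linear (transpose :: real^'n^'m \<Rightarrow> real^'m^'n)"
  by (intro linearI) (auto simp: transpose_def vec_eq_iff)

lemma inner_eq_trace: "A \<bullet> B = trace (transpose A ** B)" for A B :: "real^'n^'m"
  unfolding trace_def matrix_matrix_mult_def transpose_def inner_vec_def
  by simp (rule sum.swap)

lemma inner_transpose: "transpose A \<bullet> transpose B = A \<bullet> B" for A B :: "real^'n^'m"
  unfolding inner_vec_def transpose_def by simp (rule sum.swap)

text \<open>Together with its right-hand counterpart, this moves factors across the trace inner product without
  expanding traces.\<close>

lemma inner_matrix_mult_left: "(A ** B) \<bullet> C = B \<bullet> (transpose A ** C)" for A :: "real^'n^'m" and B :: "real^'k^'n"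
  by (simp add: inner_eq_trace matrix_transpose_mul matrix_mul_assoc)

lemma inner_matrix_mult_right: "(A ** B) \<bullet> C = A \<bullet> (C ** transpose B)" for A :: "real^'n^'m" and B :: "real^'k^'n"
  using inner_matrix_mult_left[of "transpose B" "transpose A" "transpose C"]
  by (simp add: inner_transpose flip: matrix_transpose_mul)
    (metis inner_transpose matrix_transpose_mul transpose_transpose)

lemma subspace_sym_mats: "subspace (sym_mats :: (real^'p^'p) set)"
  by (auto simp: subspace_def sym_mats_def transpose_def vec_eq_iff)

lemma sym_matsD: "A \<in> sym_mats \<Longrightarrow> transpose A = A"
  by (simp add: sym_mats_def)

lemma sym_mats_inner:
  assumes "A \<in> sym_mats"
  shows "u \<bullet> (A *v v) = (A *v u) \<bullet> v"
  using assms by (metis dot_lmul_matrix sym_matsD transpose_matrix_vector)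

definition outer :: "real^'n \<Rightarrow> real^'n^'n" where
  "outer u = (\<chi> i j. u $ i * u $ j)"

lemma outer_mult_vec: "outer u *v v = (u \<bullet> v) *\<^sub>R u"
  by (simp add: outer_def matrix_vector_mult_def inner_vec_def vec_eq_iff sum_distrib_left
      sum_distrib_right mult_ac)

lemma inner_outer: "outer u \<bullet> A = u \<bullet> (A *v u)"
  by (simp add: outer_def matrix_vector_mult_def inner_vec_def sum_distrib_left mult_ac)

lemma outer_mult_outer: "outer u ** outer v = (u \<bullet> v) *\<^sub>R (\<chi> i j. u $ i * v $ j)"
  by (simp add: outer_def matrix_matrix_mult_def inner_vec_def vec_eq_iff sum_distrib_left mult_ac)

lemma outer_psd: "outer u \<in> psd_mats"
proof -
  have "outer u \<in> sym_mats"
    by (simp add: sym_mats_def transpose_def outer_def mult.commute)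
  moreover have "0 \<le> v \<bullet> (outer u *v v)" for v
    by (simp add: outer_mult_vec inner_commute)
  ultimately show ?thesis
    by (simp add: psd_mats_def)
qed

text \<open>A maximiser \<open>v\<close> of the quadratic form over the unit sphere of the subspace is an eigenvector:
  with \<open>l\<close> the maximum, \<open>l * (u \<bullet> u) - u \<bullet> (A *v u)\<close> is nonnegative on the subspace and zero at \<open>v\<close>,
  and its first variation at \<open>v\<close> in the direction of the residual \<open>l *\<^sub>R v - A *v v\<close> is twice the
  squared norm of that residual.\<close>

lemma invariant_subspace_eigenvector:
  fixes A :: "real^'p^'p"
  assumes A: "A \<in> sym_mats" and S: "subspace S" "S \<noteq> {0}" and inv: "\<And>v. v \<in> S \<Longrightarrow> A *v v \<in> S"
  obtains v l where "v \<in> S" "norm v = 1" "A *v v = l *\<^sub>R v"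
proof -
  let ?C = "S \<inter> sphere 0 1"
  obtain w where w: "w \<in> S" "w \<noteq> 0"
    using S subspace_0[OF S(1)] by blast
  have "sgn w \<in> ?C"
    using w S by (auto simp: sgn_div_norm subspace_scale)
  moreover have "compact ?C"
    by (simp add: closed_Int_compact closed_subspace S)
  moreover have "continuous_on ?C (\<lambda>v. v \<bullet> (A *v v))"
    by (intro continuous_intros linear_continuous_on matrix_vector_mul_bounded_linear)
  ultimately obtain v where v: "v \<in> ?C" and max: "\<And>u. u \<in> ?C \<Longrightarrow> u \<bullet> (A *v u) \<le> v \<bullet> (A *v v)"
    using continuous_attains_sup[of ?C] by blast
  define l where "l = v \<bullet> (A *v v)"
  have Q: "u \<bullet> (A *v u) \<le> l * (u \<bullet> u)" if "u \<in> S" for u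
  proof (cases "u = 0")
    case False
    then have "sgn u \<in> ?C"
      using that S by (auto simp: sgn_div_norm subspace_scale)
    from max[OF this] have "(u \<bullet> (A *v u)) / (norm u)\<^sup>2 \<le> l"
      by (simp add: l_def sgn_div_norm matrix_vector_mult_scaleR power2_eq_square divide_simps)
    then show ?thesis
      using False by (simp add: divide_simps power2_norm_eq_inner)
  qed simp
  define r where "r = l *\<^sub>R v - A *v v"
  have r: "r \<in> S"
    using v S inv by (auto simp: r_def subspace_diff subspace_scale)
  have vv: "v \<bullet> v = 1"
    using v by (simp add: dot_square_norm)
  have "r \<bullet> r = 0"
  proof -
    have "0 \<le> s * (2 * (r \<bullet> r)) + s\<^sup>2 * (l * (r \<bullet> r) - r \<bullet> (A *v r))" for s
    proof -
      have "v + s *\<^sub>R r \<in> S"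
        using v r S by (auto simp: subspace_add subspace_scale)
      from Q[OF this] have "0 \<le> l * ((v + s *\<^sub>R r) \<bullet> (v + s *\<^sub>R r)) - (v + s *\<^sub>R r) \<bullet> (A *v (v + s *\<^sub>R r))"
        by simp
      also have "\<dots> = (l * (v \<bullet> v) - v \<bullet> (A *v v)) + s * (2 * (r \<bullet> (l *\<^sub>R v - A *v v)))
          + s\<^sup>2 * (l * (r \<bullet> r) - r \<bullet> (A *v r))"
        using sym_mats_inner[OF A, of v r]
        by (simp add: algebra_simps matrix_vector_right_distrib matrix_vector_mult_scaleR inner_commute
            power2_eq_square inner_add_left inner_add_right)
      finally show ?thesis
        by (simp add: l_def[symmetric] vv r_def[symmetric])
    qed
    from linear_coefficient_eq_0[OF this] show ?thesis
      by simp
  qed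
  then have "A *v v = l *\<^sub>R v"
    by (simp add: r_def)
  with v that show ?thesis
    by auto
qed

text \<open>The orthogonal complement of an eigenvector within an invariant subspace is again invariant, because
  \<open>A\<close> is self-adjoint; so eigenvectors can be split off one at a time.\<close>

lemma invariant_subspace_eigenbasis:
  fixes A :: "real^'p^'p"
  assumes A: "A \<in> sym_mats" and "subspace S" and "\<And>v. v \<in> S \<Longrightarrow> A *v v \<in> S"
  shows "\<exists>B l. finite B \<and> pairwise orthogonal B \<and> (\<forall>b\<in>B. norm b = 1 \<and> A *v b = l b *\<^sub>R b) \<and> span B = S"
  using assms(2,3)
proof (induction "dim S" arbitrary: S rule: less_induct)
  case less
  show ?case
  proof (cases "S = {0}")
    case True
    then show ?thesis
      by (intro exI[of _ "{}"]) auto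
  next
    case False
    then obtain v c where v: "v \<in> S" "norm v = 1" "A *v v = c *\<^sub>R v"
      using invariant_subspace_eigenvector[OF A less.prems(1)] less.prems(2) by metis
    let ?T = "{x \<in> S. v \<bullet> x = 0}"
    have "?T = S \<inter> {x. v \<bullet> x = 0}" by auto
    then have T: "subspace ?T"
      using less.prems(1) by (simp add: subspace_Int subspace_hyperplane subspace_inter)
    have vv: "v \<bullet> v = 1"
      using v by (simp add: dot_square_norm)
    have "v \<notin> ?T"
      using vv by simp
    then have "?T \<subset> S"
      using v(1) by blast
    then have "dim ?T < dim S"
      using T less.prems(1) by (metis dim_psubset span_eq_iff)
    moreover have "A *v x \<in> ?T" if "x \<in> ?T" for x
      using that less.prems(2) v(3) by (auto simp: sym_mats_inner[OF A])
    ultimately obtain B l where B: "finite B" "pairwise orthogonal B"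
        "\<And>b. b \<in> B \<Longrightarrow> norm b = 1 \<and> A *v b = l b *\<^sub>R b" "span B = ?T"
      using less.hyps[OF _ T] by blast
    have BT: "b \<in> ?T" if "b \<in> B" for b
      using that B(4) span_base by blast
    have "v \<notin> B"
      using BT vv by auto
    have "span (insert v B) = S"
    proof
      have "insert v B \<subseteq> S"
        using BT v by auto
      then show "span (insert v B) \<subseteq> S"
        using less.prems(1) by (rule span_minimal)
      show "S \<subseteq> span (insert v B)"
      proof
        fix x assume "x \<in> S"
        then have "x - (v \<bullet> x) *\<^sub>R v \<in> ?T"
          using v vv less.prems(1) by (auto simp: subspace_diff subspace_scale inner_diff_right)
        then show "x \<in> span (insert v B)"
          unfolding span_insert B(4) by auto
      qed
    qed
    then show ?thesis
      using B BT v \<open>v \<notin> B\<close>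
      by (intro exI[of _ "insert v B"] exI[of _ "l(v := c)"])
        (auto simp: pairwise_insert orthogonal_def inner_commute)
  qed
qed

theorem spectral_decomposition:
  fixes A :: "real^'p^'p"
  assumes "A \<in> sym_mats"
  obtains B and l :: "real^'p \<Rightarrow> real" where "finite B" "pairwise orthogonal B" "\<And>b. b \<in> B \<Longrightarrow> norm b = 1"
    "A = (\<Sum>b\<in>B. l b *\<^sub>R outer b)" "\<And>b. b \<in> B \<Longrightarrow> l b = b \<bullet> (A *v b)"
proof -
  obtain B l where B: "finite B" "pairwise orthogonal B"
      "\<And>b. b \<in> B \<Longrightarrow> norm b = 1 \<and> A *v b = l b *\<^sub>R b" "span B = UNIV"
    using invariant_subspace_eigenbasis[OF assms, of UNIV] by auto
  have "A *v x = (\<Sum>b\<in>B. l b *\<^sub>R outer b) *v x" for x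
  proof -
    have "x = (\<Sum>b\<in>B. (x \<bullet> b) *\<^sub>R b)"
      using B by (intro orthonormal_basis_expand[symmetric]) auto
    then have "A *v x = (\<Sum>b\<in>B. (x \<bullet> b) *\<^sub>R (A *v b))"
      by (metis (no_types, lifting) matrix_vector_mult_scaleR matrix_vector_mul_linear linear_sum sum.cong)
    also have "\<dots> = (\<Sum>b\<in>B. (l b *\<^sub>R outer b) *v x)"
      using B by (intro sum.cong) (auto simp: outer_mult_vec inner_commute simp flip: scaleR_matrix_vector_assoc)
    also have "\<dots> = (\<Sum>b\<in>B. l b *\<^sub>R outer b) *v x"
      by (induction B rule: infinite_finite_induct) (auto simp: matrix_vector_mult_add_rdistrib)
    finally show ?thesis .
  qed
  then have "A = (\<Sum>b\<in>B. l b *\<^sub>R outer b)"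
    by (simp add: matrix_eq)
  moreover have "l b = b \<bullet> (A *v b)" if "b \<in> B" for b
    using B(3)[OF that] by (simp add: dot_square_norm)
  ultimately show ?thesis
    using that B by blast
qed

lemma psd_sym: "A \<in> psd_mats \<Longrightarrow> A \<in> sym_mats"
  by (simp add: psd_mats_def)

lemma psd_quadratic_zero:
  fixes A :: "real^'p^'p"
  assumes "A \<in> psd_mats" "v \<bullet> (A *v v) = 0"
  shows "A *v v = 0"
proof -
  let ?w = "A *v v"
  have "0 \<le> s * (2 * (?w \<bullet> ?w)) + s\<^sup>2 * (?w \<bullet> (A *v ?w))" for s
  proof -
    have "0 \<le> (v + s *\<^sub>R ?w) \<bullet> (A *v (v + s *\<^sub>R ?w))"
      using assms(1) by (simp add: psd_mats_def)
    also have "\<dots> = v \<bullet> ?w + s * (?w \<bullet> ?w + v \<bullet> (A *v ?w)) + s\<^sup>2 * (?w \<bullet> (A *v ?w))"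
      by (simp add: algebra_simps matrix_vector_right_distrib matrix_vector_mult_scaleR
          power2_eq_square inner_add_left inner_add_right)
    finally show ?thesis
      using assms(2) sym_mats_inner[OF psd_sym[OF assms(1)], of v ?w] by simp
  qed
  from linear_coefficient_eq_0[OF this] show ?thesis
    by simp
qed

lemma psd_inner_nonneg:
  fixes X Y :: "real^'p^'p"
  assumes "X \<in> psd_mats" "Y \<in> psd_mats"
  shows "0 \<le> X \<bullet> Y"
proof -
  obtain B l where X: "X = (\<Sum>b\<in>B. l b *\<^sub>R outer b)" "\<And>b. b \<in> B \<Longrightarrow> l b = b \<bullet> (X *v b)"
    using spectral_decomposition[OF psd_sym[OF assms(1)]] by metis
  have "X \<bullet> Y = (\<Sum>b\<in>B. l b * (b \<bullet> (Y *v b)))"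
    by (simp add: X(1) inner_sum_left inner_outer)
  moreover have "0 \<le> l b * (b \<bullet> (Y *v b))" if "b \<in> B" for b
    using assms X(2)[OF that] by (auto simp: psd_mats_def)
  ultimately show ?thesis
    by (simp add: sum_nonneg)
qed

text \<open>In the spectral decomposition of \<open>X\<close> the inner product is a sum of nonnegative terms
  \<open>l b * (b \<bullet> (Y *v b))\<close>. If it vanishes, \<open>Y\<close> kills every eigenvector of \<open>X\<close> with a nonzero eigenvalue.\<close>

lemma psd_inner_eq_0_imp_mult_eq_0:
  fixes X Y :: "real^'p^'p"
  assumes "X \<in> psd_mats" "Y \<in> psd_mats" "X \<bullet> Y = 0"
  shows "X ** Y = 0"
proof -
  obtain B l where X: "X = (\<Sum>b\<in>B. l b *\<^sub>R outer b)" "\<And>b. b \<in> B \<Longrightarrow> l b = b \<bullet> (X *v b)" "finite B"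
    using spectral_decomposition[OF psd_sym[OF assms(1)]] by metis
  have nn: "0 \<le> l b * (b \<bullet> (Y *v b))" if "b \<in> B" for b
    using assms X(2)[OF that] by (auto simp: psd_mats_def)
  have "X \<bullet> Y = (\<Sum>b\<in>B. l b * (b \<bullet> (Y *v b)))"
    by (simp add: X(1) inner_sum_left inner_outer)
  then have "\<forall>b\<in>B. l b * (b \<bullet> (Y *v b)) = 0"
    using assms(3) nn X(3) by (simp add: sum_nonneg_eq_0_iff)
  then have b0: "l b = 0 \<or> Y *v b = 0" if "b \<in> B" for b
    using that psd_quadratic_zero[OF assms(2)] by auto
  have "X *v (Y *v v) = 0" for v
  proof -
    have "X *v (Y *v v) = (\<Sum>b\<in>B. (l b *\<^sub>R outer b) *v (Y *v v))"
      unfolding X(1)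
      by (induction B rule: infinite_finite_induct) (auto simp: matrix_vector_mult_add_rdistrib)
    also have "\<dots> = (\<Sum>b\<in>B. 0)"
    proof (intro sum.cong refl)
      fix b assume "b \<in> B"
      then show "(l b *\<^sub>R outer b) *v (Y *v v) = 0"
        using b0[of b] sym_mats_inner[OF psd_sym[OF assms(2)], of b v]
        by (auto simp: outer_mult_vec simp flip: scaleR_matrix_vector_assoc)
    qed
    finally show ?thesis by simp
  qed
  then show ?thesis
    by (simp add: matrix_eq matrix_vector_mul_assoc)
qed


text \<open>Matrices diagonal in a common orthonormal basis multiply by multiplying eigenvalues.\<close>

lemma outer_sum_mult:
  assumes "finite B" "pairwise orthogonal B" "\<And>b. b \<in> B \<Longrightarrow> norm b = 1"
  shows "(\<Sum>b\<in>B. f b *\<^sub>R outer b) ** (\<Sum>b\<in>B. g b *\<^sub>R outer b) = (\<Sum>b\<in>B. (f b * g b) *\<^sub>R outer b)"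
proof -
  have *: "outer b ** outer c = (if b = c then outer b else 0)" if "b \<in> B" "c \<in> B" for b c
  proof (cases "b = c")
    case True
    then show ?thesis
      using assms(3)[OF that(1)] by (simp add: outer_mult_outer dot_square_norm) (simp add: outer_def)
  next
    case False
    then have "b \<bullet> c = 0"
      using assms(2) that by (auto simp: pairwise_def orthogonal_def)
    then show ?thesis
      using False by (simp add: outer_mult_outer)
  qed
  have "(\<Sum>b\<in>B. f b *\<^sub>R outer b) ** (\<Sum>b\<in>B. g b *\<^sub>R outer b) =
      (\<Sum>b\<in>B. \<Sum>c\<in>B. (f b * g c) *\<^sub>R (outer b ** outer c))"
    by (simp add: mat_mult.sum_left mat_mult.sum_right mat_mult.scaleR_left mat_mult.scaleR_right
        scaleR_sum_right) (subst sum.swap, simp add: mult.commute)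
  also have "\<dots> = (\<Sum>b\<in>B. \<Sum>c\<in>B. if b = c then (f b * g b) *\<^sub>R outer b else 0)"
    by (intro sum.cong refl) (auto simp: *)
  also have "\<dots> = (\<Sum>b\<in>B. (f b * g b) *\<^sub>R outer b)"
    using assms(1) by (intro sum.cong refl) simp
  finally show ?thesis .
qed

section \<open>The pseudo-inverse of a symmetric matrix\<close>

text \<open>The four Penrose equations, named so that existence and uniqueness can be stated separately from the
  description operator in \<^const>\<open>pinv\<close>.\<close>

definition penrose_inverse :: "real^'n^'m \<Rightarrow> real^'m^'n \<Rightarrow> bool" where
  "penrose_inverse A B \<longleftrightarrow> A ** B ** A = A \<and> B ** A ** B = B \<and>
     transpose (A ** B) = A ** B \<and> transpose (B ** A) = B ** A"

text \<open>The two one-sided products \<open>A ** B\<close> and \<open>B ** A\<close> are the same for both inverses, as transposing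
  \<open>A ** C ** (A ** B)\<close> interchanges \<open>B\<close> and \<open>C\<close>, and transposing \<open>(B ** A) ** (C ** A)\<close> does likewise; \<open>B\<close> is recovered from them as \<open>B ** A ** B\<close>.\<close>

lemma penrose_inverse_unique:
  assumes B: "penrose_inverse A B" and C: "penrose_inverse A C"
  shows "B = C"
proof -
  have AB: "A ** B = A ** C"
  proof -
    have "A ** B = transpose (A ** C ** A ** B)"
      using B C by (simp add: penrose_inverse_def)
    also have "\<dots> = transpose (A ** B) ** transpose (A ** C)"
      by (simp add: matrix_transpose_mul matrix_mul_assoc)
    also have "\<dots> = A ** B ** A ** C"
      using B C by (simp add: penrose_inverse_def matrix_mul_assoc)
    finally show ?thesis
      using B by (simp add: penrose_inverse_def)
  qed
  have BA: "B ** A = C ** A"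
  proof -
    have "B ** A = transpose (B ** (A ** C ** A))"
      using B C by (simp add: penrose_inverse_def)
    also have "\<dots> = transpose (C ** A) ** transpose (B ** A)"
      by (simp add: matrix_transpose_mul matrix_mul_assoc)
    also have "\<dots> = C ** (A ** B ** A)"
      using B C unfolding penrose_inverse_def by (metis matrix_mul_assoc)
    also have "\<dots> = C ** A"
      using B by (metis penrose_inverse_def)
    finally show ?thesis .
  qed
  have "B = B ** (A ** B)"
    using B by (simp add: penrose_inverse_def matrix_mul_assoc)
  also have "\<dots> = C ** A ** C"
    by (simp add: AB BA matrix_mul_assoc)
  finally show ?thesis
    using C by (simp add: penrose_inverse_def)
qed

lemma pinv_eqI: "penrose_inverse A B \<Longrightarrow> pinv A = B"
  unfolding pinv_def penrose_inverse_def[symmetric]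
  by (rule the_equality) (auto intro: penrose_inverse_unique)

text \<open>Inverting the nonzero eigenvalues gives the pseudo-inverse of a symmetric matrix, so it is symmetric
  and commutes with the matrix. The value \<open>inverse 0 = 0\<close> takes care of the kernel.\<close>

lemma pinv_sym:
  fixes A :: "real^'p^'p"
  assumes "A \<in> sym_mats"
  shows "penrose_inverse A (pinv A)" "pinv A \<in> sym_mats" "A ** pinv A = pinv A ** A"
proof -
  obtain B and l :: "real^'p \<Rightarrow> real" where B: "finite B" "pairwise orthogonal B" "\<And>b. b \<in> B \<Longrightarrow> norm b = 1"
    and A: "A = (\<Sum>b\<in>B. l b *\<^sub>R outer b)"
    using spectral_decomposition[OF assms] by metis
  define M where "M = (\<Sum>b\<in>B. inverse (l b) *\<^sub>R outer b)"
  have sym: "(\<Sum>b\<in>B. f b *\<^sub>R outer b) \<in> sym_mats" for f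
    by (intro subspace_sum[OF subspace_sym_mats] subspace_scale[OF subspace_sym_mats] psd_sym outer_psd)
  note mult = outer_sum_mult[OF B]
  have "penrose_inverse A M"
    unfolding penrose_inverse_def
    by (simp add: A M_def mult sym_matsD[OF sym])
      (auto intro!: sum.cong)
  moreover from pinv_eqI[OF this] have "pinv A = M" .
  ultimately show "penrose_inverse A (pinv A)" "pinv A \<in> sym_mats" "A ** pinv A = pinv A ** A"
    using sym[of "\<lambda>b. inverse (l b)"] by (simp_all add: M_def A mult mult.commute)
qed

lemma psd_congruence:
  fixes A :: "real^'p^'p"
  assumes "A \<in> psd_mats" shows "transpose C ** A ** C \<in> psd_mats"
proof -
  have "v \<bullet> ((transpose C ** A ** C) *v v) = (C *v v) \<bullet> (A *v (C *v v))" for v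
  proof -
    have "v \<bullet> ((transpose C ** A ** C) *v v) = v \<bullet> (transpose C *v (A *v (C *v v)))"
      by (simp only: matrix_vector_mul_assoc matrix_mul_assoc)
    also have "\<dots> = (C *v v) \<bullet> (A *v (C *v v))"
      by (metis dot_lmul_matrix inner_commute transpose_matrix_vector)
    finally show ?thesis .
  qed
  then show ?thesis
    using assms by (simp add: psd_mats_def sym_mats_def matrix_transpose_mul matrix_mul_assoc)
qed

lemma pinv_psd:
  assumes "A \<in> psd_mats" shows "pinv A \<in> psd_mats"
  using psd_congruence[OF assms, of "pinv A"] pinv_sym[OF psd_sym[OF assms]]
  by (simp add: penrose_inverse_def sym_matsD)

section \<open>Normal and tangent cones of convex sets\<close>

lemma in_normal_cone:
  "v \<in> normal_cone K a \<longleftrightarrow> a \<in> K \<and> (\<forall>k\<in>K. v \<bullet> (k - a) \<le> 0)"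
  by (simp add: normal_cone_def)

lemma normal_cone_Times:
  "(v, w) \<in> normal_cone (K \<times> L) (a, b) \<longleftrightarrow> v \<in> normal_cone K a \<and> w \<in> normal_cone L b"
proof
  assume L: "(v, w) \<in> normal_cone (K \<times> L) (a, b)"
  then have ab: "a \<in> K" "b \<in> L"
    and *: "\<And>k l. k \<in> K \<Longrightarrow> l \<in> L \<Longrightarrow> v \<bullet> (k - a) + w \<bullet> (l - b) \<le> 0"
    by (auto simp: in_normal_cone)
  then show "v \<in> normal_cone K a \<and> w \<in> normal_cone L b"
    using *[of _ b] *[of a] by (auto simp: in_normal_cone)
qed (auto simp: in_normal_cone intro: add_nonpos_nonpos)

text \<open>The bipolar theorem for the cone of feasible directions: a vector outside the closure of this cone is
  strictly separated from it, and the separating functional, up to sign, is a normal.\<close>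

lemma tangent_cone_iff_polar:
  assumes "convex K" "a \<in> K"
  shows "v \<in> tangent_cone K a \<longleftrightarrow> (\<forall>n\<in>normal_cone K a. n \<bullet> v \<le> 0)"
proof
  let ?C = "cone hull ((\<lambda>k. k - a) ` K)"
  have T: "tangent_cone K a = closure ?C"
    using assms by (simp add: tangent_cone_def)
  have C: "?C = {c *\<^sub>R (k - a) | c k. 0 \<le> c \<and> k \<in> K}"
    by (auto simp: cone_hull_expl)
  {
    assume v: "v \<in> tangent_cone K a"
    show "\<forall>n\<in>normal_cone K a. n \<bullet> v \<le> 0"
    proof
      fix n assume "n \<in> normal_cone K a"
      then have "?C \<subseteq> {x. n \<bullet> x \<le> 0}"
        by (auto simp: C in_normal_cone mult_nonneg_nonpos)
      then have "closure ?C \<subseteq> {x. n \<bullet> x \<le> 0}"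
        by (rule closure_minimal) (rule closed_halfspace_le)
      then show "n \<bullet> v \<le> 0"
        using v T by auto
    qed
  next
    assume v: "\<forall>n\<in>normal_cone K a. n \<bullet> v \<le> 0"
    have "convex ((\<lambda>k. k - a) ` K)"
      using assms(1) by (simp add: convex_translation_subtract)
    then have "convex (closure ?C)"
      by (intro convex_closure convex_cone_hull)
    show "v \<in> tangent_cone K a"
    proof (rule ccontr)
      assume "v \<notin> tangent_cone K a"
      then obtain n b where n: "n \<bullet> v < b" "\<And>x. x \<in> ?C \<Longrightarrow> b < n \<bullet> x"
        using separating_hyperplane_closed_point[OF \<open>convex (closure ?C)\<close>, of v] closure_subset
        unfolding T by blast
      have "0 *\<^sub>R (a - a) \<in> ?C"
        unfolding C using assms(2) by blast
      then have "b < 0"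
        using n(2) by fastforce
      have "0 \<le> n \<bullet> (k - a)" if "k \<in> K" for k
      proof (rule ccontr)
        assume "\<not> 0 \<le> n \<bullet> (k - a)"
        moreover have "(b / (n \<bullet> (k - a))) *\<^sub>R (k - a) \<in> ?C"
          unfolding C using \<open>b < 0\<close> calculation that by (auto intro!: exI divide_nonpos_nonpos)
        ultimately show False
          using n(2) by fastforce
      qed
      then have "- n \<in> normal_cone K a"
        using assms(2) by (simp add: in_normal_cone)
      then show False
        using v n(1) \<open>b < 0\<close> by fastforce
    qed
  }
qed

lemma convex_normal_cone: "convex (normal_cone K a)"
  by (rule convexI)
    (auto simp: in_normal_cone inner_add_left intro!: add_nonpos_nonpos mult_nonneg_nonpos)

lemma normal_cone_scale: "n \<in> normal_cone K a \<Longrightarrow> 0 \<le> c \<Longrightarrow> c *\<^sub>R n \<in> normal_cone K a"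
  by (auto simp: in_normal_cone mult_nonneg_nonpos)

lemma normal_cone_between:
  assumes "b \<in> normal_cone K a" "n \<in> normal_cone K a" "0 \<le> t" "t \<le> 1"
  shows "b + t *\<^sub>R (n - b) \<in> normal_cone K a"
proof -
  have "b + t *\<^sub>R (n - b) = (1 - t) *\<^sub>R b + t *\<^sub>R n"
    by (simp add: algebra_simps)
  then show ?thesis
    using convexD_alt[OF convex_normal_cone, of b K a n t] assms by simp
qed

text \<open>The polar of the critical directions \<open>tangent_cone K a \<inter> {b}\<^sup>\<bottom>\<close> consists of limits of
  \<open>s *\<^sub>R (n - b)\<close> with \<open>n\<close> normal at \<open>a\<close>: dually, a vector \<open>v\<close> normal at \<open>b\<close> to the cone of normals is
  orthogonal to \<open>b\<close> and polar to all normals, hence tangent. The subspace \<open>U\<close> (symmetric matrices, in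
  the application) carries \<open>K\<close>, and normals are wanted inside it; components orthogonal to \<open>U\<close> do not
  affect the inequalities that define normality.\<close>

lemma polar_critical_cone_subset_tangent_normal_cone:
  fixes K :: "'a::euclidean_space set"
  assumes K: "convex K" "K \<subseteq> U" and U: "subspace U"
    and b: "b \<in> normal_cone K a" "b \<in> U"
    and w: "w \<in> U" "\<And>v. v \<in> tangent_cone K a \<Longrightarrow> b \<bullet> v = 0 \<Longrightarrow> w \<bullet> v \<le> 0"
  shows "w \<in> tangent_cone (normal_cone K a \<inter> U) b"
proof -
  let ?N = "normal_cone K a \<inter> U"
  have a: "a \<in> K"
    using b by (simp add: in_normal_cone)
  have N: "convex ?N" "b \<in> ?N"
    using b U by (auto intro: convex_Int convex_normal_cone subspace_imp_convex)
  show ?thesis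
    unfolding tangent_cone_iff_polar[OF N]
  proof
    fix v assume "v \<in> normal_cone ?N b"
    then have v: "\<And>n. n \<in> ?N \<Longrightarrow> v \<bullet> (n - b) \<le> 0"
      by (simp add: in_normal_cone)
    have "0 *\<^sub>R b \<in> ?N" "2 *\<^sub>R b \<in> ?N"
      using b U by (simp_all add: normal_cone_scale subspace_scale del: scaleR_zero_left)
    from v[OF this(1)] v[OF this(2)] have vb: "v \<bullet> b = 0"
      by (simp add: inner_diff_right)
    obtain v1 v2 where v12: "v1 \<in> span U" "\<And>u. u \<in> span U \<Longrightarrow> orthogonal v2 u" "v = v1 + v2"
      using orthogonal_subspace_decomp_exists[of U v] by metis
    have v1: "u \<bullet> v1 = u \<bullet> v" if "u \<in> U" for u
      using v12(2)[of u] that by (simp add: v12(3) orthogonal_def inner_add_right inner_commute span_base)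
    have "n \<bullet> v1 \<le> 0" if "n \<in> normal_cone K a" for n
    proof -
      obtain n1 n2 where n12: "n1 \<in> span U" "\<And>u. u \<in> span U \<Longrightarrow> orthogonal n2 u" "n = n1 + n2"
        using orthogonal_subspace_decomp_exists[of U n] by metis
      have n1: "n1 \<bullet> u = n \<bullet> u" if "u \<in> span U" for u
        using n12(2)[of u] that by (simp add: n12(3) orthogonal_def inner_add_left)
      have "n1 \<in> ?N"
        using that n12(1) a K(2) U
        by (auto simp: in_normal_cone span_eq_iff[THEN iffD2] n1 subspace_diff subset_iff)
      then have "v \<bullet> n1 \<le> 0"
        using v[of n1] vb by (simp add: inner_diff_right)
      then show ?thesis
        using n1[OF v12(1)] v1[of n1] n12(1) U by (simp add: inner_commute span_eq_iff[THEN iffD2])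
    qed
    then have "v1 \<in> tangent_cone K a"
      by (simp add: tangent_cone_iff_polar[OF K(1) a])
    then have "w \<bullet> v1 \<le> 0"
      using w(2) v1[OF b(2)] vb by (simp add: inner_commute)
    then show "v \<bullet> w \<le> 0"
      using v1[OF w(1)] by (simp add: inner_commute)
  qed
qed

text \<open>Uniform feasibility, where polyhedrality is essential: constraints active at \<open>p\<close> do not increase along
  \<open>v\<close>, and the finitely many inactive ones have slack that survives small perturbations of both the
  base point and the step. The base point may vary because the lemma is also applied along sequences
  converging to \<open>p\<close>.\<close>

lemma polyhedron_tangent_feasible:
  fixes P :: "'a::euclidean_space set"
  assumes P: "polyhedron P" "p \<in> P" and v: "v \<in> tangent_cone P p"
  obtains e d where "0 < e" "0 < d" "\<And>q s. q \<in> P \<Longrightarrow> dist q p < d \<Longrightarrow> 0 < s \<Longrightarrow> s < e \<Longrightarrow> q + s *\<^sub>R v \<in> P"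
proof -
  obtain F where F: "finite F" "P = \<Inter>F" and hs: "\<And>h. h \<in> F \<Longrightarrow> \<exists>a b. a \<noteq> 0 \<and> h = {x. a \<bullet> x \<le> b}"
    using P(1) unfolding polyhedron_def by blast
  have "\<forall>\<^sub>F x in at_right 0 \<times>\<^sub>F nhds p. snd x \<in> h \<longrightarrow> snd x + fst x *\<^sub>R v \<in> h" if h: "h \<in> F" for h
  proof -
    obtain a b where ab: "h = {x. a \<bullet> x \<le> b}"
      using hs[OF h] by blast
    have "p \<in> h"
      using h P(2) F(2) by blast
    then consider "a \<bullet> p = b" | "a \<bullet> p < b"
      using ab by fastforce
    then show ?thesis
    proof cases
      case 1
      have "a \<in> normal_cone P p"
        using 1 P(2) h F(2) ab by (auto simp: in_normal_cone inner_diff_right)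
      then have "a \<bullet> v \<le> 0"
        using v tangent_cone_iff_polar[OF polyhedron_imp_convex[OF P(1)] P(2)] by blast
      then have "q + s *\<^sub>R v \<in> h" if "q \<in> h" "0 < s" for q s
        using that mult_nonneg_nonpos[of s "a \<bullet> v"] by (simp add: ab inner_add_right)
      moreover have "\<forall>\<^sub>F s in at_right (0::real). 0 < s"
        by (simp add: eventually_at_right_less)
      then have "\<forall>\<^sub>F x in at_right (0::real) \<times>\<^sub>F nhds p. 0 < fst x"
        using eventually_prod1[of "nhds p" "\<lambda>s. 0 < s" "at_right (0::real)"] by (simp add: case_prod_unfold)
      ultimately show ?thesis
        by (auto elim: eventually_mono)
    next
      case 2
      have "((\<lambda>x. a \<bullet> (snd x + fst x *\<^sub>R v)) \<longlongrightarrow> a \<bullet> (p + 0 *\<^sub>R v)) (at_right 0 \<times>\<^sub>F nhds p)"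
        by (intro tendsto_intros filterlim_compose[OF _ filterlim_fst] filterlim_compose[OF _ filterlim_snd]
            filterlim_fst filterlim_snd)
          (auto simp: filterlim_def filtermap_fst_prod_filter at_within_def intro: order_trans[OF filtermap_fst_prod_filter])
      then have "\<forall>\<^sub>F x in at_right 0 \<times>\<^sub>F nhds p. a \<bullet> (snd x + fst x *\<^sub>R v) < b"
        using 2 by (simp add: order_tendsto_iff)
      then show ?thesis
        by (rule eventually_mono) (simp add: ab)
    qed
  qed
  then have "\<forall>\<^sub>F x in at_right 0 \<times>\<^sub>F nhds p. \<forall>h\<in>F. snd x \<in> h \<longrightarrow> snd x + fst x *\<^sub>R v \<in> h"
    using F(1) by (simp add: eventually_ball_finite)
  then have "\<forall>\<^sub>F x in at_right 0 \<times>\<^sub>F nhds p. snd x \<in> P \<longrightarrow> snd x + fst x *\<^sub>R v \<in> P"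
    by (rule eventually_mono) (auto simp: F(2))
  then obtain Q R where "\<forall>\<^sub>F s in at_right 0. Q s" "\<forall>\<^sub>F q in nhds p. R q"
    and QR: "\<And>s q. Q s \<Longrightarrow> R q \<Longrightarrow> q \<in> P \<longrightarrow> q + s *\<^sub>R v \<in> P"
    unfolding eventually_prod_filter by auto
  then obtain e d where "0 < e" "\<And>s. 0 < s \<Longrightarrow> s < e \<Longrightarrow> Q s" "0 < d" "\<And>q. dist q p < d \<Longrightarrow> R q"
    unfolding eventually_at_right_field eventually_nhds_metric by metis
  then show ?thesis
    using that[of e d] QR by blast
qed

section \<open>Tangents to the graph of a normal cone mapping\<close>

text \<open>The contingent cone to the graph of the normal cone mapping \<open>a \<mapsto> normal_cone K a \<inter> U\<close> at the point
  \<open>(a, b)\<close>, which replaces the directional derivative of the projection onto \<open>K\<close>.\<close>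

definition normal_graph_tangent ::
  "'a::euclidean_space set \<Rightarrow> 'a set \<Rightarrow> 'a \<Rightarrow> 'a \<Rightarrow> 'a \<Rightarrow> 'a \<Rightarrow> bool" where
  "normal_graph_tangent U K a b h w \<longleftrightarrow>
     (\<exists>t A B. (\<forall>n. 0 < t n \<and> B n \<in> U \<and> B n \<in> normal_cone K (A n)) \<and> t \<longlonglongrightarrow> 0 \<and>
        (\<lambda>n. (1 / t n) *\<^sub>R (A n - a)) \<longlonglongrightarrow> h \<and> (\<lambda>n. (1 / t n) *\<^sub>R (B n - b)) \<longlonglongrightarrow> w)"

lemma tendsto_of_difference_quotient:
  fixes A :: "nat \<Rightarrow> 'a::real_normed_vector" and t :: "nat \<Rightarrow> real"
  assumes "\<And>n. 0 < t n" "t \<longlonglongrightarrow> 0" "(\<lambda>n. (1 / t n) *\<^sub>R (A n - a)) \<longlonglongrightarrow> h"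
  shows "A \<longlonglongrightarrow> a"
proof -
  have "(\<lambda>n. t n *\<^sub>R ((1 / t n) *\<^sub>R (A n - a))) \<longlonglongrightarrow> 0 *\<^sub>R h"
    by (intro tendsto_intros assms)
  moreover have "t n *\<^sub>R ((1 / t n) *\<^sub>R (A n - a)) = A n - a" for n
    using assms(1)[of n] by simp
  ultimately show ?thesis
    by (simp add: LIM_zero_iff)
qed

lemma normal_graph_tangent_Times:
  assumes "normal_graph_tangent (U \<times> V) (K \<times> L) (a, c) (b, d) (h, k) (w, z)"
  shows "normal_graph_tangent U K a b h w" "normal_graph_tangent V L c d k z"
proof -
  obtain t A B where t: "\<And>n. 0 < t n" "t \<longlonglongrightarrow> 0"
    and B: "\<And>n. B n \<in> U \<times> V" "\<And>n. B n \<in> normal_cone (K \<times> L) (A n)"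
    and lim: "(\<lambda>n. (1 / t n) *\<^sub>R (A n - (a, c))) \<longlonglongrightarrow> (h, k)" "(\<lambda>n. (1 / t n) *\<^sub>R (B n - (b, d))) \<longlonglongrightarrow> (w, z)"
    using assms unfolding normal_graph_tangent_def by blast
  have "fst (B n) \<in> U" "snd (B n) \<in> V"
    "fst (B n) \<in> normal_cone K (fst (A n))" "snd (B n) \<in> normal_cone L (snd (A n))" for n
    using B[of n] normal_cone_Times[of "fst (B n)" "snd (B n)" K L "fst (A n)" "snd (A n)"]
    by (auto simp: mem_Times_iff)
  note parts = this
  show "normal_graph_tangent U K a b h w"
    using t lim[THEN tendsto_fst] parts(1,3)
    unfolding normal_graph_tangent_def fst_scaleR fst_diff fst_conv
    by (intro exI[of _ t] exI[of _ "\<lambda>n. fst (A n)"] exI[of _ "\<lambda>n. fst (B n)"]) blast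
  show "normal_graph_tangent V L c d k z"
    using t lim[THEN tendsto_snd] parts(2,4)
    unfolding normal_graph_tangent_def snd_scaleR snd_diff snd_conv
    by (intro exI[of _ t] exI[of _ "\<lambda>n. snd (A n)"] exI[of _ "\<lambda>n. snd (B n)"]) blast
qed

text \<open>First-order information valid for every convex set. The last inequality is monotonicity of the normal
  cone mapping passed to the limit.\<close>

lemma normal_graph_tangentD:
  assumes K: "convex K" and b: "b \<in> normal_cone K a" and tan: "normal_graph_tangent U K a b h w"
  shows "h \<in> tangent_cone K a" "b \<bullet> h = 0" "0 \<le> h \<bullet> w"
proof -
  obtain t A B where t: "\<And>n. 0 < t n" "t \<longlonglongrightarrow> 0"
    and B: "\<And>n. B n \<in> normal_cone K (A n)"
    and lim: "(\<lambda>n. (1 / t n) *\<^sub>R (A n - a)) \<longlonglongrightarrow> h" "(\<lambda>n. (1 / t n) *\<^sub>R (B n - b)) \<longlonglongrightarrow> w"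
    using tan unfolding normal_graph_tangent_def by blast
  have a: "a \<in> K" and A: "\<And>n. A n \<in> K"
    using b B by (auto simp: in_normal_cone)
  have "n \<bullet> h \<le> 0" if "n \<in> normal_cone K a" for n
  proof (rule tendsto_upperbound[OF _ always_eventually])
    show "(\<lambda>i. n \<bullet> ((1 / t i) *\<^sub>R (A i - a))) \<longlonglongrightarrow> n \<bullet> h"
      by (intro tendsto_intros lim)
    show "\<forall>i. n \<bullet> ((1 / t i) *\<^sub>R (A i - a)) \<le> 0"
      using that A t(1) by (auto simp: in_normal_cone intro!: divide_nonpos_pos)
  qed simp
  then show h: "h \<in> tangent_cone K a"
    by (simp add: tangent_cone_iff_polar[OF K a])
  have "0 \<le> b \<bullet> h"
  proof (rule tendsto_lowerbound[OF _ always_eventually])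
    show "(\<lambda>i. B i \<bullet> ((1 / t i) *\<^sub>R (A i - a))) \<longlonglongrightarrow> b \<bullet> h"
      by (intro tendsto_intros lim tendsto_of_difference_quotient[OF t lim(2)])
    have "0 \<le> B i \<bullet> (A i - a)" for i
      using B[of i] a by (auto simp: in_normal_cone inner_diff_right)
    then show "\<forall>i. 0 \<le> B i \<bullet> ((1 / t i) *\<^sub>R (A i - a))"
      using t(1) by (auto intro!: divide_nonneg_pos)
  qed simp
  moreover have "b \<bullet> h \<le> 0"
    using h b by (simp add: tangent_cone_iff_polar[OF K a])
  ultimately show "b \<bullet> h = 0"
    by simp
  show "0 \<le> h \<bullet> w"
  proof (rule tendsto_lowerbound[OF _ always_eventually])
    show "(\<lambda>i. ((1 / t i) *\<^sub>R (A i - a)) \<bullet> ((1 / t i) *\<^sub>R (B i - b))) \<longlonglongrightarrow> h \<bullet> w"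
      by (intro tendsto_intros lim)
    have "0 \<le> (A i - a) \<bullet> (B i - b)" for i
    proof -
      have "B i \<bullet> (a - A i) \<le> 0" "b \<bullet> (A i - a) \<le> 0"
        using B[of i] b a A[of i] by (auto simp: in_normal_cone)
      then show ?thesis
        by (simp add: inner_diff_right inner_diff_left inner_commute)
    qed
    then show "\<forall>i. 0 \<le> ((1 / t i) *\<^sub>R (A i - a)) \<bullet> ((1 / t i) *\<^sub>R (B i - b))"
      using t(1) by (auto intro!: divide_nonneg_pos)
  qed simp
qed

text \<open>A critical direction \<open>v\<close> is feasible from all nearby points of the polyhedron, so nearby normals have
  a nonpositive inner product with it, while \<open>z\<close> has inner product zero.\<close>

lemma polyhedron_normal_graph_tangent:
  assumes P: "polyhedron P" and z: "z \<in> normal_cone P p" and tan: "normal_graph_tangent U P p z h w"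
    and v: "v \<in> tangent_cone P p" "z \<bullet> v = 0"
  shows "w \<bullet> v \<le> 0"
proof -
  obtain t A B where t: "\<And>n. 0 < t n" "t \<longlonglongrightarrow> 0"
    and B: "\<And>n. B n \<in> normal_cone P (A n)"
    and lim: "(\<lambda>n. (1 / t n) *\<^sub>R (A n - p)) \<longlonglongrightarrow> h" "(\<lambda>n. (1 / t n) *\<^sub>R (B n - z)) \<longlonglongrightarrow> w"
    using tan unfolding normal_graph_tangent_def by blast
  have p: "p \<in> P"
    using z by (simp add: in_normal_cone)
  obtain e d where ed: "0 < e" "0 < d" "\<And>q s. q \<in> P \<Longrightarrow> dist q p < d \<Longrightarrow> 0 < s \<Longrightarrow> s < e \<Longrightarrow> q + s *\<^sub>R v \<in> P"
    using polyhedron_tangent_feasible[OF P p v(1)] by metis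
  show ?thesis
  proof (rule tendsto_upperbound)
    show "(\<lambda>i. ((1 / t i) *\<^sub>R (B i - z)) \<bullet> v) \<longlonglongrightarrow> w \<bullet> v"
      by (intro tendsto_intros lim)
    have "\<forall>\<^sub>F i in sequentially. dist (A i) p < d"
      using tendsto_of_difference_quotient[OF t lim(1)] ed(2) by (rule tendstoD)
    then show "\<forall>\<^sub>F i in sequentially. ((1 / t i) *\<^sub>R (B i - z)) \<bullet> v \<le> 0"
    proof (rule eventually_mono)
      fix i assume "dist (A i) p < d"
      then have "A i + (e / 2) *\<^sub>R v \<in> P"
        using ed(1) ed(3)[of "A i" "e / 2"] B[of i] by (simp add: in_normal_cone)
      then have "B i \<bullet> (A i + (e / 2) *\<^sub>R v - A i) \<le> 0"
        using B[of i] unfolding in_normal_cone by blast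
      then have "B i \<bullet> v \<le> 0"
        using ed(1) by (simp add: mult_le_0_iff)
      then show "((1 / t i) *\<^sub>R (B i - z)) \<bullet> v \<le> 0"
        using t(1)[of i] v(2) by (simp add: inner_diff_left divide_nonpos_pos)
    qed
  qed simp
qed


section \<open>Second derivatives of convex functions\<close>

text \<open>A Frechet derivative governs difference quotients along sequences that approach the base point
  tangentially to a direction, as opposed to along the ray itself.\<close>

lemma has_derivative_difference_quotient:
  fixes g :: "'a::real_normed_vector \<Rightarrow> 'b::real_normed_vector"
  assumes D: "(g has_derivative D) (at x)"
    and t: "\<And>n. 0 < t n" "t \<longlonglongrightarrow> 0" and d: "(\<lambda>n. (1 / t n) *\<^sub>R (X n - x)) \<longlonglongrightarrow> d"
  shows "(\<lambda>n. (1 / t n) *\<^sub>R (g (X n) - g x)) \<longlonglongrightarrow> D d"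
proof -
  let ?d = "\<lambda>n. (1 / t n) *\<^sub>R (X n - x)"
  have lin: "bounded_linear D"
    using D by (rule has_derivative_bounded_linear)
  have X: "X \<longlonglongrightarrow> x"
    by (rule tendsto_of_difference_quotient[OF t d])
  have nd: "\<forall>\<^sub>F n in sequentially. norm (?d n) < norm d + 1"
    using tendsto_norm[OF d] by (rule order_tendstoD) simp
  have "(\<lambda>n. (1 / t n) *\<^sub>R (g (X n) - g x) - D (?d n)) \<longlonglongrightarrow> 0"
  proof (rule tendstoI)
    fix e :: real assume "0 < e"
    define c where "c = e / (norm d + 1)"
    have "0 < norm d + 1"
      using norm_ge_zero[of d] by linarith
    then have c: "0 < c" "c * (norm d + 1) = e"
      using \<open>0 < e\<close> by (auto simp: c_def)
    obtain r where r: "0 < r" "\<And>y. norm (y - x) < r \<Longrightarrow> norm (g y - g x - D (y - x)) \<le> c * norm (y - x)"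
      using D c(1) unfolding has_derivative_at_alt by blast
    have "\<forall>\<^sub>F n in sequentially. dist (X n) x < r"
      using X r(1) by (rule tendstoD)
    with nd show "\<forall>\<^sub>F n in sequentially. dist ((1 / t n) *\<^sub>R (g (X n) - g x) - D (?d n)) 0 < e"
    proof eventually_elim
      case (elim n)
      have "(1 / t n) *\<^sub>R (g (X n) - g x) - D (?d n) = (1 / t n) *\<^sub>R (g (X n) - g x - D (X n - x))"
        unfolding linear_scale[OF bounded_linear.linear[OF lin]] by (simp only: scaleR_diff_right)
      then have "norm ((1 / t n) *\<^sub>R (g (X n) - g x) - D (?d n)) = (1 / t n) * norm (g (X n) - g x - D (X n - x))"
        using t(1)[of n] by simp
      also have "\<dots> \<le> (1 / t n) * (c * norm (X n - x))"
        using r(2)[of "X n"] elim(2) t(1)[of n] by (intro mult_left_mono) (auto simp: dist_norm)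
      also have "\<dots> = c * norm (?d n)"
        using t(1)[of n] by simp
      also have "\<dots> < e"
        using elim(1) c by (metis mult_strict_left_mono)
      finally show ?case by simp
    qed
  qed
  moreover have "(\<lambda>n. D (?d n)) \<longlonglongrightarrow> D d"
    by (rule bounded_linear.tendsto[OF lin d])
  ultimately have "(\<lambda>n. ((1 / t n) *\<^sub>R (g (X n) - g x) - D (?d n)) + D (?d n)) \<longlonglongrightarrow> 0 + D d"
    by (rule tendsto_add)
  then show ?thesis by simp
qed

text \<open>Steps \<open>1 / (n + 1)\<close> along a fixed direction are enough to carry convexity inequalities over to the
  first and second derivatives.\<close>

lemma has_derivative_ray_quotient:
  fixes g :: "'a::real_normed_vector \<Rightarrow> 'b::real_normed_vector"
  assumes D: "(g has_derivative D) (at x)"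
  shows "(\<lambda>n. real (Suc n) *\<^sub>R (g (x + inverse (real (Suc n)) *\<^sub>R d) - g x)) \<longlonglongrightarrow> D d"
  using has_derivative_difference_quotient[OF D, of "\<lambda>n. inverse (real (Suc n))" "\<lambda>n. x + inverse (real (Suc n)) *\<^sub>R d" d]
    LIMSEQ_inverse_real_of_nat
  by (simp add: divide_inverse del: of_nat_Suc)

lemma convex_gradient_inequality:
  fixes f :: "'a::euclidean_space \<Rightarrow> real"
  assumes f: "convex_on UNIV f" and g: "(f has_derivative (\<lambda>h. g \<bullet> h)) (at x)"
  shows "f x + g \<bullet> (y - x) \<le> f y"
proof -
  have "g \<bullet> (y - x) \<le> f y - f x"
  proof (rule tendsto_upperbound[OF has_derivative_ray_quotient[OF g] always_eventually], safe)
    fix n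
    let ?s = "inverse (real (Suc n))"
    have s: "0 < ?s" "?s \<le> 1"
      by (auto simp: field_simps)
    have "f ((1 - ?s) *\<^sub>R x + ?s *\<^sub>R y) \<le> (1 - ?s) * f x + ?s * f y"
      using convex_onD[OF f, of ?s x y] s by simp
    also have "(1 - ?s) *\<^sub>R x + ?s *\<^sub>R y = x + ?s *\<^sub>R (y - x)"
      by (simp add: algebra_simps)
    finally have "f (x + ?s *\<^sub>R (y - x)) - f x \<le> ?s * (f y - f x)"
      by (simp add: algebra_simps)
    then have "real (Suc n) * (f (x + ?s *\<^sub>R (y - x)) - f x) \<le> real (Suc n) * (?s * (f y - f x))"
      by (intro mult_left_mono) auto
    then show "real (Suc n) *\<^sub>R (f (x + ?s *\<^sub>R (y - x)) - f x) \<le> f y - f x"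
      by (simp add: mult.assoc[symmetric] del: of_nat_Suc)
  qed simp
  then show ?thesis by simp
qed

context
  fixes f :: "'a::euclidean_space \<Rightarrow> real" and g D x
  assumes f: "convex_on UNIV f" and g: "\<And>y. (f has_derivative (\<lambda>h. g y \<bullet> h)) (at y)"
    and D: "(g has_derivative D) (at x)"
begin

lemma convex_gradient_monotone: "0 \<le> (g y - g z) \<bullet> (y - z)"
  using convex_gradient_inequality[OF f g, of z y] convex_gradient_inequality[OF f g, of y z]
  by (simp add: inner_diff_left inner_diff_right)

lemma convex_hessian_nonneg: "0 \<le> d \<bullet> D d"
proof (rule tendsto_lowerbound[OF tendsto_inner[OF tendsto_const has_derivative_ray_quotient[OF D]] always_eventually], safe)
  fix n
  let ?s = "inverse (real (Suc n))"
  have "0 \<le> (g (x + ?s *\<^sub>R d) - g x) \<bullet> (?s *\<^sub>R d)"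
    using convex_gradient_monotone[of "x + ?s *\<^sub>R d" x] by simp
  then have "0 \<le> ?s * ((g (x + ?s *\<^sub>R d) - g x) \<bullet> d)"
    by simp
  then have "0 \<le> (g (x + ?s *\<^sub>R d) - g x) \<bullet> d"
    by (simp add: zero_le_mult_iff del: of_nat_Suc)
  then show "0 \<le> d \<bullet> (real (Suc n) *\<^sub>R (g (x + ?s *\<^sub>R d) - g x))"
    by (simp add: inner_commute del: of_nat_Suc)
qed simp

text \<open>For a positive semidefinite symmetric form this is the Cauchy--Schwarz inequality. Symmetry of the
  second derivative is replaced here by a second appeal to convexity: combining three gradient
  inequalities gives \<open>w \<bullet> D d \<le> (d + w) \<bullet> D (d + w)\<close>, whose linear part in \<open>w\<close> forces \<open>d \<bullet> D w = 0\<close>;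
  then nonnegativity at \<open>d + s *\<^sub>R D d\<close> forces \<open>D d = 0\<close>.\<close>

lemma convex_hessian_kernel:
  assumes d: "d \<bullet> D d = 0"
  shows "D d = 0"
proof -
  have lin: "linear D"
    using D by (simp add: has_derivative_bounded_linear bounded_linear.linear)
  have sub: "w \<bullet> D d \<le> (d + w) \<bullet> D (d + w)" for w
  proof (rule tendsto_le)
    let ?s = "\<lambda>n. inverse (real (Suc n))"
    show "(\<lambda>n. w \<bullet> (real (Suc n) *\<^sub>R (g (x + ?s n *\<^sub>R d) - g x))) \<longlonglongrightarrow> w \<bullet> D d"
      by (intro tendsto_intros has_derivative_ray_quotient[OF D])
    show "(\<lambda>n. (d + w) \<bullet> (real (Suc n) *\<^sub>R (g (x + ?s n *\<^sub>R (d + w)) - g x))) \<longlonglongrightarrow> (d + w) \<bullet> D (d + w)"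
      by (intro tendsto_intros has_derivative_ray_quotient[OF D])
    show "\<forall>\<^sub>F n in sequentially. w \<bullet> (real (Suc n) *\<^sub>R (g (x + ?s n *\<^sub>R d) - g x))
        \<le> (d + w) \<bullet> (real (Suc n) *\<^sub>R (g (x + ?s n *\<^sub>R (d + w)) - g x))"
    proof (rule always_eventually, safe)
      fix n
      define s where "s = ?s n"
      have s: "0 < s" "real (Suc n) * s = 1"
        by (auto simp: s_def simp del: of_nat_Suc)
      define y z where "y = x + s *\<^sub>R d" and "z = x + s *\<^sub>R (d + w)"
      have "f x + g x \<bullet> (y - x) \<le> f y" "f y + g y \<bullet> (z - y) \<le> f z" "f z + g z \<bullet> (x - z) \<le> f x"
        by (intro convex_gradient_inequality f g)+
      then have "g x \<bullet> (y - x) + g y \<bullet> (z - y) + g z \<bullet> (x - z) \<le> 0"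
        by simp
      then have "(g y - g x) \<bullet> (z - y) \<le> (g z - g x) \<bullet> (z - x)"
        by (simp add: inner_diff_left inner_diff_right)
      then have "s * (w \<bullet> (g y - g x)) \<le> s * ((d + w) \<bullet> (g z - g x))"
        by (simp add: y_def z_def algebra_simps inner_commute)
      then have "w \<bullet> (g y - g x) \<le> (d + w) \<bullet> (g z - g x)"
        using s(1) by simp
      then show "w \<bullet> (real (Suc n) *\<^sub>R (g (x + ?s n *\<^sub>R d) - g x))
          \<le> (d + w) \<bullet> (real (Suc n) *\<^sub>R (g (x + ?s n *\<^sub>R (d + w)) - g x))"
        unfolding s_def[symmetric] y_def[symmetric] z_def[symmetric] inner_scaleR_right
        by (intro mult_left_mono) auto
    qed
  qed simp
  have left: "d \<bullet> D w = 0" for w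
  proof (rule linear_coefficient_eq_0)
    fix s :: real
    show "0 \<le> s * (d \<bullet> D w) + s\<^sup>2 * (w \<bullet> D w)"
      using sub[of "s *\<^sub>R w"] d
      by (simp add: linear_add[OF lin] linear_scale[OF lin] inner_add_left inner_add_right
          power2_eq_square algebra_simps)
  qed
  have "D d \<bullet> D d = 0"
  proof (rule linear_coefficient_eq_0)
    fix s :: real
    show "0 \<le> s * (D d \<bullet> D d) + s\<^sup>2 * (D d \<bullet> D (D d))"
      using convex_hessian_nonneg[of "d + s *\<^sub>R D d"] d left
      by (simp add: linear_add[OF lin] linear_scale[OF lin] inner_add_left inner_add_right
          power2_eq_square algebra_simps)
  qed
  then show ?thesis by simp
qed

end

section \<open>The cone of negative semidefinite matrices\<close>

lemma nsd_mats_iff: "A \<in> nsd_mats \<longleftrightarrow> - A \<in> psd_mats"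
  unfolding nsd_mats_def by (metis (no_types, lifting) imageE image_eqI minus_minus)

lemma nsd_sym: "A \<in> nsd_mats \<Longrightarrow> A \<in> sym_mats"
  using subspace_neg[OF subspace_sym_mats, of "- A"] by (simp add: nsd_mats_iff psd_sym)

lemma psd_iff_inner_outer: "A \<in> psd_mats \<longleftrightarrow> A \<in> sym_mats \<and> (\<forall>v. 0 \<le> A \<bullet> outer v)"
  by (simp add: psd_mats_def inner_outer inner_commute[of A])

lemma convex_psd: "convex psd_mats"
proof -
  have "psd_mats = sym_mats \<inter> (\<Inter>v. {A. 0 \<le> A \<bullet> outer v})"
    by (auto simp: psd_iff_inner_outer)
  moreover have "convex {A. 0 \<le> A \<bullet> outer v}" for v :: "real^'p"
    using convex_halfspace_ge[of 0 "outer v"] by (simp add: inner_commute)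
  ultimately show ?thesis
    using convex_Int[OF subspace_imp_convex[OF subspace_sym_mats] convex_INT[of UNIV]] by metis
qed

lemma closed_psd: "closed psd_mats"
proof -
  have "psd_mats = sym_mats \<inter> (\<Inter>v. {A. 0 \<le> A \<bullet> outer v})"
    by (auto simp: psd_iff_inner_outer)
  moreover have "closed {A. 0 \<le> A \<bullet> outer v}" for v :: "real^'p"
    using closed_halfspace_ge[of 0 "outer v"] by (simp add: inner_commute)
  ultimately show ?thesis
    using closed_Int[OF closed_subspace[OF subspace_sym_mats] closed_INT[of UNIV]] by metis
qed

lemma convex_nsd: "convex nsd_mats" and closed_nsd: "closed nsd_mats"
  unfolding nsd_mats_def by (simp_all add: convex_psd closed_psd convex_negations closed_negations)

lemma zero_psd: "0 \<in> psd_mats"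
  by (simp add: psd_iff_inner_outer subspace_0 subspace_sym_mats)

lemma psd_add: "A \<in> psd_mats \<Longrightarrow> B \<in> psd_mats \<Longrightarrow> A + B \<in> psd_mats"
  by (simp add: psd_iff_inner_outer inner_add_left subspace_add subspace_sym_mats)

text \<open>Testing normality at \<open>0\<close> and \<open>2 *\<^sub>R A\<close> gives \<open>Y \<bullet> A = 0\<close>, and testing it at \<open>A - outer v\<close> gives that \<open>Y\<close>
  is positive semidefinite. Complementarity in the trace inner product then becomes the matrix equation
  \<open>Y ** A = 0\<close>, which can be differentiated.\<close>

lemma normal_cone_nsd:
  assumes "Y \<in> sym_mats"
  shows "Y \<in> normal_cone nsd_mats A \<longleftrightarrow> A \<in> nsd_mats \<and> Y \<in> psd_mats \<and> Y ** A = 0"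
proof
  assume Y: "Y \<in> normal_cone nsd_mats A"
  then have A: "A \<in> nsd_mats" and N: "\<And>k. k \<in> nsd_mats \<Longrightarrow> Y \<bullet> (k - A) \<le> 0"
    by (auto simp: in_normal_cone)
  have "2 *\<^sub>R A \<in> nsd_mats" "0 \<in> nsd_mats"
    using A by (auto simp: nsd_mats_iff psd_iff_inner_outer subspace_scale[OF subspace_sym_mats, of _ 2] zero_psd
        subspace_0[OF subspace_sym_mats] dest: subspace_scale[OF subspace_sym_mats, of _ 2])
  from N[OF this(1)] N[OF this(2)] have YA: "Y \<bullet> A = 0"
    by (simp add: inner_diff_right)
  have "0 \<le> Y \<bullet> outer v" for v
  proof -
    have "A - outer v \<in> nsd_mats"
      using psd_add[of "- A" "outer v"] A outer_psd[of v] by (simp add: nsd_mats_iff)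
    from N[OF this] show ?thesis
      by simp
  qed
  then have "Y \<in> psd_mats"
    using assms by (simp add: psd_iff_inner_outer)
  moreover from psd_inner_eq_0_imp_mult_eq_0[OF this, of "- A"] have "Y ** A = 0"
    using A YA by (simp add: nsd_mats_iff mat_mult.minus_right)
  ultimately show "A \<in> nsd_mats \<and> Y \<in> psd_mats \<and> Y ** A = 0"
    using A by simp
next
  assume R: "A \<in> nsd_mats \<and> Y \<in> psd_mats \<and> Y ** A = 0"
  then have "Y \<bullet> A = 0"
    using sym_matsD[OF assms] by (simp add: inner_eq_trace trace_def)
  moreover have "Y \<bullet> k \<le> 0" if "k \<in> nsd_mats" for k
    using psd_inner_nonneg[of Y "- k"] that R by (simp add: nsd_mats_iff)
  ultimately show "Y \<in> normal_cone nsd_mats A"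
    using R by (simp add: in_normal_cone inner_diff_right)
qed

text \<open>Both parts come from explicit normals: skew-symmetric matrices are normal to every set of symmetric
  matrices, and \<open>outer v\<close> is normal at \<open>A\<close> whenever \<open>A *v v = 0\<close>.\<close>

lemma tangent_cone_nsd:
  assumes A: "A \<in> nsd_mats" and H: "H \<in> tangent_cone nsd_mats A"
  shows "H \<in> sym_mats" and "A ** C = 0 \<Longrightarrow> - (transpose C ** H ** C) \<in> psd_mats"
proof -
  have pol: "n \<bullet> H \<le> 0" if "n \<in> normal_cone nsd_mats A" for n
    using H that by (simp add: tangent_cone_iff_polar[OF convex_nsd A])
  let ?S = "H - transpose H"
  have "?S \<bullet> k = 0" if "k \<in> sym_mats" for k
    using inner_transpose[of H k] sym_matsD[OF that] by (simp add: inner_diff_left)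
  then have "?S \<in> normal_cone nsd_mats A"
    using A by (simp add: in_normal_cone inner_diff_right nsd_sym)
  from pol[OF this] have "?S \<bullet> ?S \<le> 0"
    using inner_transpose[of H H] inner_transpose[of H "transpose H"]
    by (simp add: inner_diff_left inner_diff_right inner_commute)
  then have "?S = 0"
    by (metis inner_eq_zero_iff inner_ge_zero order_antisym)
  then show sym: "H \<in> sym_mats"
    by (simp add: sym_mats_def)
  assume C: "A ** C = 0"
  have "0 \<le> - (transpose C ** H ** C) \<bullet> outer v" for v
  proof -
    have AC: "A *v (C *v v) = 0"
      by (simp add: matrix_vector_mul_assoc C)
    then have "outer (C *v v) \<in> normal_cone nsd_mats A"
      using A by (auto simp: in_normal_cone inner_outer matrix_vector_mult_diff_rdistrib
          nsd_mats_iff psd_iff_inner_outer inner_commute[of _ "outer _"])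
    from pol[OF this] have "(C *v v) \<bullet> (H *v (C *v v)) \<le> 0"
      by (simp add: inner_outer)
    also have "(C *v v) \<bullet> (H *v (C *v v)) = v \<bullet> (transpose C *v (H *v (C *v v)))"
      by (metis dot_lmul_matrix inner_commute transpose_matrix_vector)
    also have "\<dots> = (transpose C ** H ** C) \<bullet> outer v"
      by (simp only: inner_commute[of _ "outer v"] inner_outer matrix_vector_mul_assoc matrix_mul_assoc)
    finally show ?thesis by simp
  qed
  moreover have "- (transpose C ** H ** C) \<in> sym_mats"
    using sym by (intro subspace_neg subspace_sym_mats)
      (simp add: sym_mats_def matrix_transpose_mul matrix_mul_assoc)
  ultimately show "- (transpose C ** H ** C) \<in> psd_mats"
    by (simp add: psd_iff_inner_outer)
qed

text \<open>A matrix of the negative semidefinite cone with a symmetric normal. In an eigenbasis common to both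
  matrices there are three blocks: \<open>Y\<close> is positive, both vanish, \<open>A\<close> is negative. The blocks are handled
  through projections built from pseudo-inverses, so that no basis has to be chosen.\<close>

locale complementary_pair =
  fixes A Y :: "real^'p^'p"
  assumes A: "A \<in> nsd_mats" and Y: "Y \<in> psd_mats" and YA: "Y ** A = 0"
begin

definition M where "M = pinv (- A)"
text \<open>The orthogonal projection onto the kernel of \<open>A\<close>.\<close>

definition Z where "Z = mat 1 + M ** A"

lemma sym: "transpose A = A" "transpose Y = Y"
  using A Y by (simp_all add: nsd_sym psd_sym sym_matsD)

lemma AY: "A ** Y = 0"
  by (metis YA matrix_transpose_mul sym transpose_iff mat_mult.zero_left)

lemma M_psd: "M \<in> psd_mats"
  using A by (simp add: M_def nsd_mats_iff pinv_psd)

lemma M_sym: "transpose M = M"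
  using M_psd by (simp add: psd_sym sym_matsD)

lemma M_A: "A ** M = M ** A" "A ** M ** A = - A" "M ** A ** M = - M"
  using pinv_sym(1,3)[of "- A"] A
  by (simp_all add: M_def[symmetric] nsd_mats_iff psd_sym penrose_inverse_def mat_mult.minus_left
      mat_mult.minus_right minus_equation_iff[of _ A] minus_equation_iff[of _ M])

lemma YM: "Y ** M = 0"
proof -
  have "- M ** Y = M ** M ** (A ** Y)"
    by (metis M_A(1,3) matrix_mul_assoc)
  then have "M ** Y = 0"
    by (simp add: AY mat_mult.minus_left)
  then show ?thesis
    by (metis matrix_transpose_mul sym M_sym transpose_iff mat_mult.zero_left)
qed

lemma Z_sym: "transpose Z = Z"
proof -
  have "transpose (M ** A) = M ** A"
    by (simp add: matrix_transpose_mul sym M_sym M_A(1))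
  then show ?thesis
    by (simp add: Z_def linear_add[OF linear_transpose])
qed

lemma Z: "A ** Z = 0" "Z ** A = 0" "Y ** Z = Y" "Z ** Y = Y"
proof -
  show AZ: "A ** Z = 0"
    by (simp add: Z_def mat_mult.add_right matrix_mul_assoc M_A(2))
  show "Z ** A = 0"
    using AZ by (metis matrix_transpose_mul sym(1) Z_sym transpose_iff mat_mult.zero_left)
  show YZ: "Y ** Z = Y"
    by (simp add: Z_def mat_mult.add_right matrix_mul_assoc YM)
  show "Z ** Y = Y"
    using YZ by (metis matrix_transpose_mul sym(2) Z_sym)
qed

text \<open>Compressed to the kernel of \<open>A\<close>, a tangent direction is negative semidefinite, and its inner product
  with \<open>Y\<close> is unchanged, so vanishing of the inner product makes the product vanish.\<close>

lemma critical_direction: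
  assumes H: "H \<in> tangent_cone nsd_mats A" "Y \<bullet> H = 0"
  shows "Y ** H ** Z = 0"
proof -
  have "- (Z ** H ** Z) \<in> psd_mats"
    using tangent_cone_nsd(2)[OF A H(1) Z(1)] by (simp add: Z_sym)
  moreover have "Y \<bullet> (Z ** H ** Z) = 0"
  proof -
    have "(Z ** H ** Z) \<bullet> Y = (Z ** H) \<bullet> (Y ** Z)"
      by (simp add: inner_matrix_mult_right Z_sym)
    also have "\<dots> = H \<bullet> (Z ** Y)"
      by (simp add: inner_matrix_mult_left Z_sym Z)
    finally show ?thesis
      using H(2) by (simp add: Z inner_commute)
  qed
  ultimately have "Y ** (Z ** H ** Z) = 0"
    using psd_inner_eq_0_imp_mult_eq_0[OF Y, of "- (Z ** H ** Z)"] by (simp add: mat_mult.minus_right)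
  then show ?thesis
    by (simp add: matrix_mul_assoc Z)
qed

text \<open>On the range of \<open>A\<close>: \<open>Y ** (H ** M ** H) = 0\<close> gives \<open>M ** (H ** Y) = 0\<close> because \<open>M\<close> is positive
  semidefinite. On the kernel of \<open>A\<close> the previous lemma applies.\<close>

lemma flat_critical_direction:
  assumes H: "H \<in> tangent_cone nsd_mats A" "Y \<bullet> H = 0" and flat: "Y \<bullet> (H ** M ** H) = 0"
  shows "Y ** H = 0"
proof -
  have Hs: "transpose H = H"
    using tangent_cone_nsd(1)[OF A H(1)] by (rule sym_matsD)
  have HMH: "H ** M ** H \<in> psd_mats"
    using psd_congruence[OF M_psd, of H] by (simp add: Hs)
  have "Y ** H ** M ** H = 0"
    using psd_inner_eq_0_imp_mult_eq_0[OF Y HMH flat] by (simp add: matrix_mul_assoc)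
  then have 0: "(Y ** (H ** M ** H)) ** Y = 0"
    by (simp add: matrix_mul_assoc)
  have MHY: "M *v ((H ** Y) *v v) = 0" for v
  proof (rule psd_quadratic_zero[OF M_psd])
    have "((H ** Y) *v v) \<bullet> (M *v ((H ** Y) *v v)) = v \<bullet> (transpose (H ** Y) *v (M *v ((H ** Y) *v v)))"
      by (metis dot_lmul_matrix inner_commute transpose_matrix_vector)
    also have "\<dots> = v \<bullet> ((Y ** (H ** M ** H) ** Y) *v v)"
      by (simp only: matrix_transpose_mul sym Hs matrix_vector_mul_assoc matrix_mul_assoc)
    finally show "((H ** Y) *v v) \<bullet> (M *v ((H ** Y) *v v)) = 0"
      by (simp add: 0)
  qed
  then have "M ** (H ** Y) = 0"
    by (simp add: matrix_eq matrix_vector_mul_assoc)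
  then have "Y ** H ** M = 0"
    by (metis matrix_transpose_mul sym Hs M_sym transpose_iff mat_mult.zero_left mat_mult.zero_right
        matrix_mul_assoc)
  then have "Y ** H ** Z = Y ** H"
    by (simp add: Z_def mat_mult.add_right matrix_mul_assoc)
  then show ?thesis
    using critical_direction[OF H] by simp
qed

lemma curvature_nonneg:
  assumes "H \<in> sym_mats"
  shows "0 \<le> Y \<bullet> (H ** M ** H)"
  using psd_inner_nonneg[OF Y psd_congruence[OF M_psd, of H]] by (simp add: sym_matsD[OF assms])

text \<open>All parts are limits along a sequence of pairs of matrices that satisfy \<open>An n ** Yn n = 0\<close> and whose
  second components are positive semidefinite. The first-order limit of the equation is \<open>H ** Y + A ** W = 0\<close>. Between factors \<open>C\<close> and \<open>E\<close> that kill \<open>A\<close> and \<open>Y\<close> the first-order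
  terms disappear, and the second-order limit is \<open>C ** H ** W ** E = 0\<close>.\<close>

lemma normal_graph_tangent_nsd:
  assumes tan: "normal_graph_tangent sym_mats nsd_mats A Y H W"
  shows "transpose W = W" "A ** W = - (H ** Y)"
    and "C ** A = 0 \<Longrightarrow> Y ** E = 0 \<Longrightarrow> C ** H ** W ** E = 0"
    and "R \<in> psd_mats \<Longrightarrow> Y \<bullet> R = 0 \<Longrightarrow> 0 \<le> W \<bullet> R"
proof -
  obtain t An Yn where t: "\<And>n. 0 < t n" "t \<longlonglongrightarrow> 0"
    and Yn: "\<And>n. Yn n \<in> sym_mats" "\<And>n. Yn n \<in> normal_cone nsd_mats (An n)"
    and lim: "(\<lambda>n. (1 / t n) *\<^sub>R (An n - A)) \<longlonglongrightarrow> H" "(\<lambda>n. (1 / t n) *\<^sub>R (Yn n - Y)) \<longlonglongrightarrow> W"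
    using tan unfolding normal_graph_tangent_def by blast
  have nc: "An n \<in> nsd_mats" "Yn n \<in> psd_mats" "Yn n ** An n = 0" for n
    using Yn normal_cone_nsd by blast+
  have An_Yn: "An n ** Yn n = 0" for n
    using nc(3)[of n] sym_matsD[OF nsd_sym[OF nc(1)[of n]]] sym_matsD[OF Yn(1)[of n]]
    by (metis matrix_transpose_mul transpose_iff mat_mult.zero_left)
  have Ws: "W \<in> sym_mats"
  proof (rule Lim_in_closed_set[OF closed_subspace[OF subspace_sym_mats] _ _ lim(2)])
    show "\<forall>\<^sub>F n in sequentially. (1 / t n) *\<^sub>R (Yn n - Y) \<in> sym_mats"
      using Yn(1) psd_sym[OF Y] by (simp add: subspace_scale subspace_diff subspace_sym_mats)
  qed simp
  then show "transpose W = W"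
    by (rule sym_matsD)
  show "A ** W = - (H ** Y)"
  proof -
    have "(\<lambda>n. (1 / t n) *\<^sub>R (An n - A) ** Yn n + A ** ((1 / t n) *\<^sub>R (Yn n - Y))) \<longlonglongrightarrow> H ** Y + A ** W"
      by (intro tendsto_intros mat_mult.tendsto lim tendsto_of_difference_quotient[OF t lim(2)])
    moreover have "(1 / t n) *\<^sub>R (An n - A) ** Yn n + A ** ((1 / t n) *\<^sub>R (Yn n - Y)) = 0" for n
      by (simp add: mat_mult.scaleR_left mat_mult.scaleR_right mat_mult.diff_left mat_mult.diff_right
          An_Yn AY scaleR_diff_right)
    ultimately have "H ** Y + A ** W = 0"
      by (simp add: LIMSEQ_const_iff)
    then show ?thesis
      by (simp add: add_eq_0_iff)
  qed
  show "C ** H ** W ** E = 0" if CE: "C ** A = 0" "Y ** E = 0"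
  proof -
    have "(\<lambda>n. C ** ((1 / t n) *\<^sub>R (An n - A)) ** ((1 / t n) *\<^sub>R (Yn n - Y)) ** E) \<longlonglongrightarrow> C ** H ** W ** E"
      by (intro tendsto_intros mat_mult.tendsto lim)
    moreover have "C ** ((1 / t n) *\<^sub>R (An n - A)) ** ((1 / t n) *\<^sub>R (Yn n - Y)) ** E = 0" for n
    proof -
      have "C ** (An n - A) ** (Yn n - Y) ** E = C ** (An n - A) ** ((Yn n - Y) ** E)"
        by (simp add: matrix_mul_assoc)
      also have "\<dots> = C ** (An n ** Yn n) ** E"
        by (simp add: CE mat_mult.diff_left mat_mult.diff_right matrix_mul_assoc)
      finally show ?thesis
        by (simp add: An_Yn mat_mult.scaleR_left mat_mult.scaleR_right)
    qed
    ultimately show ?thesis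
      by (simp add: LIMSEQ_const_iff)
  qed
  show "0 \<le> W \<bullet> R" if R: "R \<in> psd_mats" "Y \<bullet> R = 0"
  proof (rule tendsto_lowerbound[OF _ always_eventually])
    show "(\<lambda>n. ((1 / t n) *\<^sub>R (Yn n - Y)) \<bullet> R) \<longlonglongrightarrow> W \<bullet> R"
      by (intro tendsto_intros lim)
    show "\<forall>n. 0 \<le> ((1 / t n) *\<^sub>R (Yn n - Y)) \<bullet> R"
      using psd_inner_nonneg[OF nc(2) R(1)] t(1) R(2) by (simp add: inner_diff_left less_imp_le)
  qed simp
qed

text \<open>The curvature of the cone. Writing the identity as \<open>Z - M ** A\<close> splits \<open>H \<bullet> W\<close> into a part on the kernel
  of \<open>A\<close> and cross terms. The cross terms are determined by \<open>A ** W = - (H ** Y)\<close> and add up to the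
  right-hand side. The compression of \<open>H\<close> to the kernel of \<open>A\<close> is carried by the common kernel of \<open>A\<close>
  and \<open>Y\<close>, with projection \<open>Q\<close>, and there the second-order limit \<open>Q ** H ** W ** Q = 0\<close> makes the contribution vanish.\<close>

lemma normal_graph_tangent_curvature:
  assumes tan: "normal_graph_tangent sym_mats nsd_mats A Y H W"
  shows "H \<bullet> W = 2 * (Y \<bullet> (H ** M ** H))"
proof -
  have "Y \<in> normal_cone nsd_mats A"
    using normal_cone_nsd[OF psd_sym[OF Y]] A Y YA by simp
  from normal_graph_tangentD[OF convex_nsd this tan]
  have H: "H \<in> tangent_cone nsd_mats A" "Y \<bullet> H = 0"
    by simp_all
  have Hs: "transpose H = H"
    using tangent_cone_nsd(1)[OF A H(1)] by (rule sym_matsD)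
  note W = normal_graph_tangent_nsd[OF tan]
  have WA: "W ** A = - (Y ** H)"
  proof -
    have "transpose (W ** A) = - (H ** Y)"
      by (simp add: matrix_transpose_mul W(1,2) sym)
    then have "W ** A = transpose (- (H ** Y))"
      by (metis transpose_transpose)
    then show ?thesis
      by (simp add: linear_neg[OF linear_transpose] matrix_transpose_mul Hs sym)
  qed
  define N where "N = pinv Y"
  have N: "Y ** N ** Y = Y" "Y ** N = N ** Y"
    using pinv_sym(1,3)[OF psd_sym[OF Y]] by (simp_all add: N_def penrose_inverse_def)
  \<comment> \<open>\<open>Y ** N\<close> projects onto the range of \<open>Y\<close>, which lies in the kernel of \<open>A\<close>; so \<open>Q\<close> projects onto
    the common kernel of \<open>A\<close> and \<open>Y\<close>.\<close>
  define Q where "Q = Z - Y ** N"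
  have QA: "Q ** A = 0"
    by (simp add: Q_def mat_mult.diff_left Z N(2) YA flip: matrix_mul_assoc)
  have QY: "Q ** Y = 0" and YQ: "Y ** Q = 0"
    using N(1) by (simp_all add: Q_def mat_mult.diff_left mat_mult.diff_right Z matrix_mul_assoc)
      (metis N matrix_mul_assoc)
  have "- (Q ** M) = Q ** A ** M ** M"
    by (metis M_A(1,3) matrix_mul_assoc mat_mult.minus_right)
  then have QM: "Q ** M = 0"
    by (simp add: QA)
  have QZ: "Q ** Z = Q"
    by (simp add: Z_def mat_mult.add_right matrix_mul_assoc QM)
  have QQ: "Q ** Q = Q"
    unfolding Q_def[of] mat_mult.diff_right by (simp add: QZ QY matrix_mul_assoc Q_def[symmetric])
  have YHZ: "Y ** H ** Z = 0"
    by (rule critical_direction[OF H])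
  have ZHY: "Z ** H ** Y = 0"
    using YHZ by (metis Hs Z_sym sym(2) matrix_transpose_mul matrix_mul_assoc transpose_iff mat_mult.zero_left mat_mult.zero_right)
  have QHY: "Q ** H ** Y = 0"
    by (metis QZ ZHY matrix_mul_assoc mat_mult.zero_right)
  have ZHZ: "Z ** H ** Z = Q ** H ** Q"
  proof -
    have "Z ** H ** Z - Z ** H ** Q = Z ** H ** Y ** N"
      by (simp add: Q_def mat_mult.diff_right matrix_mul_assoc)
    moreover have "Z ** H ** Q - Q ** H ** Q = N ** (Y ** H ** Z) - N ** (Y ** H ** Y) ** N"
      unfolding Q_def N(2) by (simp add: mat_mult.diff_right mat_mult.diff_left matrix_mul_assoc N(2)[symmetric])
    moreover have "Y ** H ** Y = 0"
      by (metis Z(3) ZHY matrix_mul_assoc mat_mult.zero_right)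
    ultimately show ?thesis
      by (simp add: ZHY YHZ)
  qed
  have split: "X = Q ** X + Y ** N ** X - M ** A ** X" for X :: "real^'p^'p"
    by (simp add: Q_def Z_def mat_mult.add_left mat_mult.diff_left)
  have MAW: "M ** A ** W = - (M ** H ** Y)"
    using W(2) by (metis matrix_mul_assoc mat_mult.minus_right)
  have "Q ** H ** Q ** W ** Q = 0"
  proof -
    have "Q ** H ** W ** Q = Q ** H ** (Q ** W + Y ** N ** W - M ** A ** W) ** Q"
      using split[of W] by simp
    also have "\<dots> = Q ** H ** Q ** W ** Q + (Q ** H ** Y) ** N ** W ** Q + Q ** H ** M ** H ** (Y ** Q)"
      by (simp add: MAW mat_mult.add_left mat_mult.add_right mat_mult.diff_left mat_mult.diff_right matrix_mul_assoc
          mat_mult.minus_left mat_mult.minus_right)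
    finally show ?thesis
      using W(3)[OF QA YQ] by (simp add: QHY YQ)
  qed
  then have "trace (Q ** H ** Q ** W) = 0"
    using trace_mul_sym[of Q "Q ** H ** Q ** W"] by (simp add: matrix_mul_assoc QQ trace_def)
  then have "trace (Z ** H ** Z ** W) = 0"
    by (simp add: ZHZ)
  moreover have "H \<bullet> W = trace (Z ** H ** Z ** W) + 2 * (Y \<bullet> (H ** M ** H))"
  proof -
    have one: "X = Z ** X - M ** A ** X" "X = X ** Z - X ** M ** A" for X :: "real^'p^'p"
      by (simp_all add: Z_def mat_mult.add_left mat_mult.add_right matrix_mul_assoc)
    have "H ** W = H ** (Z ** W - M ** A ** W)"
      using one(1)[of W] by simp
    also have "\<dots> = H ** Z ** W + H ** M ** H ** Y"
      by (simp add: MAW mat_mult.add_right matrix_mul_assoc)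
    also have "H ** Z ** W = H ** Z ** W ** Z - H ** Z ** W ** M ** A"
      by (rule one(2))
    also have "H ** Z ** W ** M ** A = H ** Z ** (W ** A) ** M"
      by (simp add: M_A(1) flip: matrix_mul_assoc)
    also have "\<dots> = - (H ** (Z ** Y) ** H ** M)"
      by (simp add: WA mat_mult.minus_left mat_mult.minus_right matrix_mul_assoc)
    finally have "H ** W = H ** Z ** W ** Z + H ** Y ** H ** M + H ** M ** H ** Y"
      by (simp add: Z)
    moreover have "H \<bullet> W = trace (H ** W)"
      by (simp add: inner_eq_trace Hs)
    moreover have "trace (H ** Z ** W ** Z) = trace (Z ** H ** Z ** W)"
      using trace_mul_sym[of "H ** Z ** W" Z] by (simp add: matrix_mul_assoc)
    moreover have "trace (H ** M ** H ** Y) = Y \<bullet> (H ** M ** H)"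
      using trace_mul_sym[of "H ** M ** H" Y] by (simp add: inner_eq_trace sym)
    moreover have "trace (H ** Y ** H ** M) = Y \<bullet> (H ** M ** H)"
      using trace_mul_sym[of H "Y ** H ** M"] trace_mul_sym[of "Y ** H ** M" H]
      by (simp add: inner_eq_trace sym matrix_mul_assoc)
    ultimately show ?thesis
      by (simp add: trace_add)
  qed
  ultimately show ?thesis
    by simp
qed

text \<open>If the matrix does not move to first order, the change \<open>W\<close> of the normal is carried by the kernel of
  \<open>A\<close>. There \<open>V\<close> is negative semidefinite and orthogonal to \<open>Y\<close>, whereas the nearby normals are positive
  semidefinite.\<close>

lemma vertical_normal_graph_tangent:
  assumes tan: "normal_graph_tangent sym_mats nsd_mats A Y 0 W"
    and V: "V \<in> tangent_cone nsd_mats A" "Y \<bullet> V = 0"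
  shows "W \<bullet> V \<le> 0"
proof -
  note W = normal_graph_tangent_nsd[OF tan]
  have AW: "A ** W = 0"
    using W(2) by simp
  then have WA: "W ** A = 0"
    using W(1) sym(1) by (metis matrix_transpose_mul transpose_iff mat_mult.zero_left)
  have ZW: "Z ** W = W" and WZ: "W ** Z = W"
    by (simp_all add: Z_def mat_mult.add_left mat_mult.add_right AW WA M_A(1)[symmetric] matrix_mul_assoc flip: M_A(1))
      (metis AW M_A(1) matrix_mul_assoc mat_mult.zero_right)
  have *: "(Z ** V ** Z) \<bullet> X = V \<bullet> (Z ** X ** Z)" for X
    using inner_matrix_mult_right[of "Z ** V" Z X] inner_matrix_mult_left[of Z V "X ** Z"]
    by (simp add: Z_sym matrix_mul_assoc)
  have "- (Z ** V ** Z) \<in> psd_mats"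
    using tangent_cone_nsd(2)[OF A V(1) Z(1)] by (simp add: Z_sym)
  moreover have "Y \<bullet> - (Z ** V ** Z) = 0"
    using *[of Y] V(2) by (simp add: Z inner_commute)
  ultimately have "0 \<le> W \<bullet> - (Z ** V ** Z)"
    by (rule W(4))
  then show ?thesis
    using *[of W] by (simp add: ZW WZ inner_commute)
qed

end

section \<open>Isolated calmness and directions of vanishing residual\<close>

text \<open>The form in which calmness is contradicted: along no ray can the residual be small compared with
  the distance travelled. The bound \<open>\<eta>\<close> is half the reciprocal of the calmness modulus.\<close>

lemma isolated_calm_no_flat_ray:
  fixes G :: "'a::real_normed_vector \<Rightarrow> 'b::real_normed_vector"
  assumes "isolated_calm (\<lambda>w. {u \<in> S. G u = w}) 0 u"
  obtains \<eta> where "0 < \<eta>"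
    "\<And>D \<tau>. 0 < \<tau> \<Longrightarrow> (\<And>t. 0 < t \<Longrightarrow> t < \<tau> \<Longrightarrow> u + t *\<^sub>R D \<in> S \<and> norm (G (u + t *\<^sub>R D)) \<le> \<eta> * norm (t *\<^sub>R D)) \<Longrightarrow> D = 0"
proof -
  obtain \<kappa> V W where k: "0 < \<kappa>" "open V" "0 \<in> V" "open W" "u \<in> W"
    and calm: "\<And>u'. u' \<in> S \<Longrightarrow> G u' \<in> V \<Longrightarrow> u' \<in> W \<Longrightarrow> norm (u' - u) \<le> \<kappa> * norm (G u')"
    using assms unfolding isolated_calm_def by fastforce
  obtain e where e: "0 < e" "ball 0 e \<subseteq> V" "ball u e \<subseteq> W"
  proof -
    obtain e1 e2 where "0 < e1" "ball 0 e1 \<subseteq> V" "0 < e2" "ball u e2 \<subseteq> W"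
      using k by (meson open_contains_ball)
    then show ?thesis
      by (intro that[of "min e1 e2"]) auto
  qed
  define \<eta> where "\<eta> = 1 / (2 * \<kappa>)"
  show ?thesis
  proof (rule that)
    show "0 < \<eta>"
      using k(1) by (simp add: \<eta>_def)
    fix D \<tau>
    assume \<tau>: "0 < \<tau>" "\<And>t. 0 < t \<Longrightarrow> t < \<tau> \<Longrightarrow> u + t *\<^sub>R D \<in> S \<and> norm (G (u + t *\<^sub>R D)) \<le> \<eta> * norm (t *\<^sub>R D)"
    show "D = 0"
    proof (rule ccontr)
      assume "D \<noteq> 0"
      define t where "t = min (\<tau> / 2) (e / (2 * (1 + \<eta>) * norm D))"
      have t: "0 < t" "t < \<tau>"
        using \<tau>(1) e(1) \<open>0 < \<eta>\<close> \<open>D \<noteq> 0\<close> by (auto simp: t_def)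
      have tD: "norm (t *\<^sub>R D) = t * norm D"
        using t by simp
      have "t * norm D \<le> e / (2 * (1 + \<eta>) * norm D) * norm D"
        unfolding t_def by (intro mult_right_mono) auto
      also have "\<dots> = e / (2 * (1 + \<eta>))"
        using \<open>D \<noteq> 0\<close> by simp
      finally have "(1 + \<eta>) * (t * norm D) \<le> (1 + \<eta>) * (e / (2 * (1 + \<eta>)))"
        using \<open>0 < \<eta>\<close> by (intro mult_left_mono) auto
      also have "\<dots> = e / 2"
        using \<open>0 < \<eta>\<close> by (simp add: field_simps)
      finally have small: "t * norm D + \<eta> * (t * norm D) < e"
        using e(1) by (simp add: algebra_simps)
      have pos: "0 < t * norm D"
        using t \<open>D \<noteq> 0\<close> by simp
      then have "0 < \<eta> * (t * norm D)"
        using \<open>0 < \<eta>\<close> by simp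
      note \<tau>t = \<tau>(2)[OF t, unfolded tD]
      have "G (u + t *\<^sub>R D) \<in> V" "u + t *\<^sub>R D \<in> W"
        using \<tau>t small pos \<open>0 < \<eta> * (t * norm D)\<close> e(2,3) tD by (auto simp: subset_iff dist_norm)
      then have "norm (u + t *\<^sub>R D - u) \<le> \<kappa> * norm (G (u + t *\<^sub>R D))"
        using \<tau>t by (intro calm) auto
      also have "\<dots> \<le> \<kappa> * (\<eta> * (t * norm D))"
        using \<tau>t k(1) by (intro mult_left_mono) auto
      also have "\<dots> = t * norm D / 2"
        using k(1) by (simp add: \<eta>_def)
      finally have "t * norm D \<le> t * norm D / 2"
        using tD by (simp only: add_diff_cancel_left')
      then show False
        using pos by linarith
    qed
  qed
qed

text \<open>Failure of calmness with modulus \<open>n + 1\<close> on the ball of radius \<open>1 / (n + 1)\<close>, for every \<open>n\<close>, gives a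
  sequence whose normalised displacements have a limit point on the unit sphere.\<close>

lemma not_isolated_calm_direction:
  fixes G :: "'a::euclidean_space \<Rightarrow> 'b::real_normed_vector"
  assumes u: "u \<in> S" "G u = 0" and not: "\<not> isolated_calm (\<lambda>w. {u \<in> S. G u = w}) 0 u"
  obtains t :: "nat \<Rightarrow> real" and X D where "\<And>n. 0 < t n" "t \<longlonglongrightarrow> 0" "\<And>n. X n \<in> S" "norm D = 1"
    "(\<lambda>n. (1 / t n) *\<^sub>R (X n - u)) \<longlonglongrightarrow> D" "(\<lambda>n. (1 / t n) *\<^sub>R G (X n)) \<longlonglongrightarrow> 0"
proof -
  have "\<exists>x\<in>S. dist x u < inverse (real (Suc n)) \<and> real (Suc n) * norm (G x) < norm (x - u)" for n
  proof (rule ccontr)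
    assume C: "\<not> ?thesis"
    have "norm (x - u) \<le> real (Suc n) * norm (a' - 0)"
      if "x \<in> S" "G x = a'" "x \<in> ball u (inverse (real (Suc n)))" for a' x
      using C that by (auto simp: not_less dist_commute simp del: of_nat_Suc)
    then have "\<forall>a'\<in>UNIV. {u \<in> S. G u = a'} \<inter> ball u (inverse (real (Suc n)))
        \<subseteq> {x. norm (x - u) \<le> real (Suc n) * norm (a' - 0)}"
      by blast
    moreover have "0 < real (Suc n)" "u \<in> ball u (inverse (real (Suc n)))"
      by simp_all
    ultimately have "isolated_calm (\<lambda>w. {u \<in> S. G u = w}) 0 u"
      unfolding isolated_calm_def using u open_UNIV UNIV_I open_ball by blast
    with not show False ..
  qed
  then obtain X where X: "\<And>n. X n \<in> S" "\<And>n. dist (X n) u < inverse (real (Suc n))"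
      "\<And>n. real (Suc n) * norm (G (X n)) < norm (X n - u)"
    by metis
  \<comment> \<open>The distance to \<open>u\<close> is the natural scale: after division by it, displacements are unit vectors and
    residuals are at most \<open>1 / (n + 1)\<close>.\<close>
  define t where "t n = norm (X n - u)" for n
  have t: "0 < t n" for n
    unfolding t_def by (rule le_less_trans[OF _ X(3)]) (simp del: of_nat_Suc)
  have t0: "t \<longlonglongrightarrow> 0"
  proof (rule real_tendsto_sandwich[OF _ _ tendsto_const LIMSEQ_inverse_real_of_nat])
    show "\<forall>\<^sub>F n in sequentially. 0 \<le> t n"
      using t by (simp add: less_imp_le)
    show "\<forall>\<^sub>F n in sequentially. t n \<le> inverse (real (Suc n))"
      using X(2) by (simp add: t_def dist_norm less_imp_le)
  qed
  have G0: "(\<lambda>n. (1 / t n) *\<^sub>R G (X n)) \<longlonglongrightarrow> 0"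
  proof (rule tendsto_norm_zero_cancel, rule real_tendsto_sandwich[OF _ _ tendsto_const LIMSEQ_inverse_real_of_nat])
    show "\<forall>\<^sub>F n in sequentially. 0 \<le> norm ((1 / t n) *\<^sub>R G (X n))"
      by simp
    show "\<forall>\<^sub>F n in sequentially. norm ((1 / t n) *\<^sub>R G (X n)) \<le> inverse (real (Suc n))"
    proof (rule always_eventually, rule allI)
      fix n
      have "norm (G (X n)) \<le> inverse (real (Suc n)) * t n"
        using X(3)[of n] by (simp add: t_def field_simps)
      then show "norm ((1 / t n) *\<^sub>R G (X n)) \<le> inverse (real (Suc n))"
        using t[of n] by (simp add: pos_divide_le_eq del: of_nat_Suc)
    qed
  qed
  have "\<forall>n. (1 / t n) *\<^sub>R (X n - u) \<in> sphere 0 1"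
    using t by (simp add: t_def)
  then have "\<exists>D\<in>sphere 0 1. \<exists>r. strict_mono r \<and> ((\<lambda>n. (1 / t n) *\<^sub>R (X n - u)) \<circ> r) \<longlonglongrightarrow> D"
    using compact_sphere[of "0::'a" 1, unfolded compact_def, THEN spec, of "\<lambda>n. (1 / t n) *\<^sub>R (X n - u)"]
    by (rule mp[rotated])
  then obtain D r where D: "D \<in> sphere 0 1" "strict_mono r"
      "((\<lambda>n. (1 / t n) *\<^sub>R (X n - u)) \<circ> r) \<longlonglongrightarrow> D"
    by (elim bexE exE conjE)
  show ?thesis
  proof (rule that[of "t \<circ> r" "X \<circ> r" D])
    show "(t \<circ> r) \<longlonglongrightarrow> 0"
      by (rule LIMSEQ_subseq_LIMSEQ[OF t0 D(2)])
    show "(\<lambda>n. (1 / (t \<circ> r) n) *\<^sub>R G ((X \<circ> r) n)) \<longlonglongrightarrow> 0"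
      using LIMSEQ_subseq_LIMSEQ[OF G0 D(2)] by (simp add: o_def)
    show "(\<lambda>n. (1 / (t \<circ> r) n) *\<^sub>R ((X \<circ> r) n - u)) \<longlonglongrightarrow> D"
      using D(3) by (simp add: o_def)
  qed (use D t X in auto)
qed

lemma closest_point_add_normal:
  assumes K: "convex K" "closed K" and b: "b \<in> normal_cone K a"
  shows "closest_point K (a + b) = a"
proof -
  have a: "a \<in> K"
    using b by (simp add: in_normal_cone)
  have "dist (a + b) a \<le> dist (a + b) k" if "k \<in> K" for k
  proof -
    have "0 \<le> (norm (k - a))\<^sup>2 - 2 * (b \<bullet> (k - a))"
      using b that by (auto simp: in_normal_cone intro: add_nonneg_nonneg)
        (metis diff_ge_0_iff_ge mult_nonneg_nonpos order_trans zero_le_numeral zero_le_power2)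
    then have "(norm b)\<^sup>2 \<le> (norm (b - (k - a)))\<^sup>2"
      by (simp add: power2_norm_eq_inner inner_diff_left inner_diff_right inner_commute)
    then have "norm b \<le> norm (b - (k - a))"
      by (rule power2_le_imp_le) simp
    then show ?thesis
      by (simp add: dist_norm algebra_simps)
  qed
  then show ?thesis
    using closest_point_unique[OF K a] by metis
qed

lemma diff_closest_point_normal:
  assumes "convex K" "closed K" "K \<noteq> {}"
  shows "q - closest_point K q \<in> normal_cone K (closest_point K q)"
  using closest_point_dot[OF assms(1,2)] closest_point_in_set[OF assms(2,3)] by (simp add: in_normal_cone)

text \<open>An approximate solution of the complementarity equation can be exhibited without computing a
  projection: if \<open>b\<close> is normal at a point \<open>a\<close> near \<open>q\<close>, nonexpansiveness bounds the residual at \<open>q\<close>.\<close>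

lemma projection_residual_le:
  assumes K: "convex K" "closed K" and b: "b \<in> normal_cone K a"
  shows "norm (- q + closest_point K (q + b)) \<le> 2 * norm (a - q)"
proof -
  have "norm (closest_point K (q + b) - closest_point K (a + b)) \<le> norm (q - a)"
    using closest_point_lipschitz[of K "q + b" "a + b"] K b by (auto simp: dist_norm in_normal_cone)
  then have "norm (closest_point K (q + b) - a) \<le> norm (a - q)"
    using closest_point_add_normal[OF K b] by (simp add: norm_minus_commute)
  moreover have "norm (- q + closest_point K (q + b)) \<le> norm (closest_point K (q + b) - a) + norm (a - q)"
    using norm_triangle_ineq[of "closest_point K (q + b) - a" "a - q"] by simp
  ultimately show ?thesis by simp
qed

text \<open>Separation of a point from a convex cone that need not be closed; working inside the span of the
  translated cone keeps the separating vector in \<open>U\<close>.\<close>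

lemma convex_cone_proper_polar:
  fixes R :: "'a::euclidean_space set"
  assumes U: "subspace U" "R \<subset> U" and R: "0 \<in> R" "\<And>x y. x \<in> R \<Longrightarrow> y \<in> R \<Longrightarrow> x + y \<in> R"
    "\<And>x c. x \<in> R \<Longrightarrow> 0 \<le> c \<Longrightarrow> c *\<^sub>R x \<in> R"
  obtains w where "w \<in> U" "w \<noteq> 0" "\<And>r. r \<in> R \<Longrightarrow> w \<bullet> r \<le> 0"
proof -
  obtain u where u: "u \<in> U" "u \<notin> R"
    using U(2) by blast
  let ?S = "(\<lambda>r. r - u) ` R"
  have "convex R"
    using R by (auto simp: convex_def)
  then have "convex ?S"
    by (simp add: convex_translation_subtract)
  moreover have "?S \<noteq> {}" "0 \<notin> ?S"
    using R(1) u(2) by auto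
  ultimately obtain a where a: "a \<in> span ?S" "a \<noteq> 0" "\<And>x. x \<in> ?S \<Longrightarrow> 0 \<le> a \<bullet> x"
    using separating_hyperplane_set_0_inspan[of ?S] by metis
  have "?S \<subseteq> U"
    using U u(1) by (auto intro: subspace_diff)
  then have "a \<in> U"
    using a(1) U(1) span_minimal by blast
  moreover have "0 \<le> a \<bullet> r" if "r \<in> R" for r
  proof (rule ccontr)
    assume neg: "\<not> 0 \<le> a \<bullet> r"
    define c where "c = (\<bar>a \<bullet> u\<bar> + 1) / - (a \<bullet> r)"
    have "0 \<le> c"
      using neg by (simp add: c_def divide_le_0_iff)
    then have "0 \<le> a \<bullet> (c *\<^sub>R r - u)"
      using R(3)[OF that] a(3) by blast
    moreover have "c * (a \<bullet> r) = - (\<bar>a \<bullet> u\<bar> + 1)"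
      using neg by (auto simp: c_def)
    ultimately show False
      by (simp add: inner_diff_right abs_if split: if_splits)
  qed
  ultimately show ?thesis
    using that[of "- a"] a(2) U(1) by (simp add: subspace_neg)
qed

section \<open>The affine conic problem\<close>

lemma gradient_eqI: "GDERIV f x :> g \<Longrightarrow> gradient f x = g"
proof -
  assume g: "GDERIV f x :> g"
  have "h = g" if "GDERIV f x :> h" for h
  proof -
    have "(\<lambda>v. v \<bullet> g) = (\<lambda>v. v \<bullet> h)"
      using g that unfolding gderiv_def by (rule has_derivative_unique)
    then have "(h - g) \<bullet> (h - g) = 0"
      by (metis (no_types) cancel_comm_monoid_add_class.diff_cancel inner_diff_right)
    then show ?thesis by simp
  qed
  with g show ?thesis
    unfolding gradient_def by blast
qed

lemma convex_constr_set: "polyhedron P \<Longrightarrow> convex (constr_set P)"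
  and closed_constr_set: "polyhedron P \<Longrightarrow> closed (constr_set P)"
  unfolding constr_set_def
  by (simp_all add: convex_Times closed_Times convex_nsd closed_nsd polyhedron_imp_convex polyhedron_imp_closed)

lemma constr_set_subset: "constr_set P \<subseteq> sym_mats \<times> UNIV"
  by (auto simp: constr_set_def nsd_sym)

lemma subspace_sym_Times: "subspace (sym_mats \<times> (UNIV :: 'z::euclidean_space set))"
  by (simp add: subspace_Times subspace_sym_mats)

lemma tangent_cone_TimesD:
  assumes KL: "convex K" "convex L" "a \<in> K" "b \<in> L" and v: "(v, w) \<in> tangent_cone (K \<times> L) (a, b)"
  shows "v \<in> tangent_cone K a" "w \<in> tangent_cone L b"
proof -
  have pol: "n \<bullet> v + m \<bullet> w \<le> 0" if "n \<in> normal_cone K a" "m \<in> normal_cone L b" for n m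
  proof -
    have "(n, m) \<in> normal_cone (K \<times> L) (a, b)"
      using that by (simp add: normal_cone_Times)
    then have "(n, m) \<bullet> (v, w) \<le> 0"
      using v KL by (simp add: tangent_cone_iff_polar convex_Times del: inner_Pair)
    then show ?thesis by simp
  qed
  have "0 \<in> normal_cone K a" "0 \<in> normal_cone L b"
    using KL by (simp_all add: in_normal_cone)
  then show "v \<in> tangent_cone K a" "w \<in> tangent_cone L b"
    using pol[of _ 0] pol[of 0] KL by (auto simp: tangent_cone_iff_polar)
qed

text \<open>The data of the problem with the derivatives made explicit: \<open>g\<close> is the gradient of \<open>f\<close>, \<open>D\<close> its second
  derivative at \<open>x\<close>, and \<open>L\<close> the linear part of the constraint map. The pair \<open>(Y, z)\<close> is the multiplier at
  which calmness is examined.\<close>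

locale affine_convex_problem =
  fixes f :: "'x::euclidean_space \<Rightarrow> real" and \<phi> :: "'x \<Rightarrow> real^'p^'p"
    and \<psi> :: "'x \<Rightarrow> 'z::euclidean_space" and P :: "'z set"
    and x :: 'x and Y :: "real^'p^'p" and z :: 'z
    and g :: "'x \<Rightarrow> 'x" and D :: "'x \<Rightarrow> 'x" and L :: "'x \<Rightarrow> (real^'p^'p) \<times> 'z" and c
  assumes phi_sym: "\<And>u. \<phi> u \<in> sym_mats" and P: "polyhedron P"
    and f: "convex_on UNIV f" and g: "\<And>u. (f has_derivative (\<lambda>h. g u \<bullet> h)) (at u)"
    and D: "(g has_derivative D) (at x)"
    and L: "linear L" and affine: "\<And>u. constr_map \<phi> \<psi> u = L u + c"
    and mult: "(Y, z) \<in> multipliers f \<phi> \<psi> P x"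
begin

abbreviation "K \<equiv> constr_set P"
abbreviation "U \<equiv> sym_mats \<times> (UNIV :: 'z set)"
abbreviation "q \<equiv> constr_map \<phi> \<psi>"

lemma q_U: "q u \<in> U"
  by (simp add: constr_map_def phi_sym)

lemma L_diff: "L (u - v) = q u - q v"
  by (simp add: affine linear_diff[OF L])

lemma q_ray: "q (x + t *\<^sub>R d) = q x + t *\<^sub>R L d"
  by (simp add: affine linear_add[OF L] linear_scale[OF L])

lemma L_U: "L d \<in> U"
  using L_diff[of d 0] q_U[of d] q_U[of 0] by (simp add: subspace_diff subspace_sym_Times)

lemma q_derivative: "(q has_derivative L) (at u)"
proof -
  have "q = (\<lambda>u. L u + c)"
    using affine by auto
  moreover have "((\<lambda>u. L u + c) has_derivative L) (at u)"
    using bounded_linear_imp_has_derivative[of L "at u"] L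
    by (auto intro!: has_derivative_add_const simp: linear_conv_bounded_linear)
  ultimately show ?thesis by simp
qed

lemma frechet_q: "frechet_derivative q (at u) = L"
  by (rule frechet_derivative_at[OF q_derivative, symmetric])

lemma frechet_phi: "frechet_derivative \<phi> (at u) = (\<lambda>d. fst (L d))"
  using frechet_derivative_at[OF has_derivative_fst[OF q_derivative]] by (simp add: constr_map_def)

lemma frechet_f: "frechet_derivative f (at u) = (\<lambda>d. g u \<bullet> d)"
  by (rule frechet_derivative_at[OF g, symmetric])

lemma lagrangian_inner: "lagrangian f \<phi> \<psi> u y w = f u + (y, w) \<bullet> q u"
  by (simp add: lagrangian_def constr_map_def)

lemma grad_lagrangian_eq: "grad_lagrangian f \<phi> \<psi> u y w = g u + adjoint L (y, w)"
proof -
  have "((\<lambda>u. f u + (y, w) \<bullet> q u) has_derivative (\<lambda>h. g u \<bullet> h + (y, w) \<bullet> L h)) (at u)"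
    by (intro has_derivative_add g has_derivative_inner_right q_derivative)
  moreover have "(\<lambda>h. g u \<bullet> h + (y, w) \<bullet> L h) = (\<lambda>h. h \<bullet> (g u + adjoint L (y, w)))"
    by (simp add: fun_eq_iff inner_add_right adjoint_works[OF L] inner_commute del: inner_Pair)
  ultimately show ?thesis
    unfolding grad_lagrangian_def lagrangian_inner
    by (intro gradient_eqI) (simp add: gderiv_def)
qed

text \<open>An affine constraint contributes nothing to the Hessian, which is therefore the same for all
  multipliers.\<close>

lemma hess_lagrangian_eq: "hess_lagrangian f \<phi> \<psi> x y w = D"
proof -
  have "((\<lambda>u. g u + adjoint L (y, w)) has_derivative D) (at x)"
    by (intro has_derivative_add_const D)
  then show ?thesis
    unfolding hess_lagrangian_def grad_lagrangian_eq by (rule frechet_derivative_at[symmetric])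
qed

lemma multipliers_iff:
  "b \<in> multipliers f \<phi> \<psi> P x \<longleftrightarrow> b \<in> U \<and> g x + adjoint L b = 0 \<and> b \<in> normal_cone K (q x)"
  by (cases b) (auto simp: multipliers_def grad_lagrangian_eq)

lemma KKT_conditions: "(Y, z) \<in> U" "g x + adjoint L (Y, z) = 0" "(Y, z) \<in> normal_cone K (q x)"
  using mult by (auto simp: multipliers_iff)

lemma KKT_map_eq: "KKT_map f \<phi> \<psi> P (u, b) = (g u + adjoint L b, - q u + closest_point K (q u + b))"
  by (cases b) (simp add: KKT_map_def grad_lagrangian_eq)

lemma KKT_inverse_eq: "KKT_inverse f \<phi> \<psi> P = (\<lambda>w. {u \<in> UNIV \<times> U. KKT_map f \<phi> \<psi> P u = w})"
  by (simp add: KKT_inverse_def fun_eq_iff)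

lemmas K = convex_constr_set[OF P] closed_constr_set[OF P]

lemma q_x: "q x \<in> K" "\<phi> x \<in> nsd_mats" "\<psi> x \<in> P"
  using KKT_conditions(3) by (auto simp: in_normal_cone constr_set_def constr_map_def)

lemma component_normals: "Y \<in> sym_mats" "Y \<in> normal_cone nsd_mats (\<phi> x)" "z \<in> normal_cone P (\<psi> x)"
  using KKT_conditions(1,3) by (simp_all add: constr_set_def constr_map_def normal_cone_Times)

sublocale complementary_pair "\<phi> x" Y
  using component_normals normal_cone_nsd[OF component_normals(1)] by unfold_locales auto

lemma tangent_components:
  assumes "(v, w) \<in> tangent_cone K (q x)"
  shows "v \<in> tangent_cone nsd_mats (\<phi> x)" "w \<in> tangent_cone P (\<psi> x)"
  using tangent_cone_TimesD[of nsd_mats P "\<phi> x" "\<psi> x" v w] assms q_x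
  by (simp_all add: constr_set_def constr_map_def convex_nsd polyhedron_imp_convex P)

lemma tangent_polar: "v \<in> tangent_cone K (q x) \<longleftrightarrow> (\<forall>n\<in>normal_cone K (q x). n \<bullet> v \<le> 0)"
  using K(1) q_x(1) by (rule tangent_cone_iff_polar)

text \<open>The critical directions, taken in the image space.\<close>

definition critical_tangents where
  "critical_tangents = tangent_cone K (q x) \<inter> orthogonal_comp {(Y, z)}"

lemma critical_tangents_iff: "v \<in> critical_tangents \<longleftrightarrow> v \<in> tangent_cone K (q x) \<and> (Y, z) \<bullet> v = 0"
  by (auto simp: critical_tangents_def orthogonal_comp_def orthogonal_def inner_commute)

text \<open>By stationarity the derivative of \<open>f\<close> along \<open>d\<close> is \<open>- ((Y, z) \<bullet> L d)\<close>, which is nonnegative on tangent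
  directions; so the inequality in the critical cone amounts to orthogonality to the multiplier.\<close>

lemma critical_cone_iff: "d \<in> critical_cone f \<phi> \<psi> P x \<longleftrightarrow> L d \<in> critical_tangents"
proof -
  have "g x \<bullet> d = - ((Y, z) \<bullet> L d)"
    using KKT_conditions(2) adjoint_works[OF L, of d "(Y, z)"]
    by (simp add: eq_neg_iff_add_eq_0[symmetric] inner_commute del: inner_Pair)
  moreover have "(Y, z) \<bullet> L d \<le> 0" if "L d \<in> tangent_cone K (q x)"
    using that KKT_conditions(3) by (simp add: tangent_polar)
  ultimately show ?thesis
    by (auto simp: critical_cone_def critical_tangents_iff frechet_q frechet_f)
qed

text \<open>The constraint qualification in dual form: a convex cone fills the space of symmetric pairs if and only
  if only \<open>0\<close> is polar to it within that space, and being polar to the subspace \<open>range L\<close> means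
  \<open>adjoint L w = 0\<close>.\<close>

lemma SRCQ_iff:
  "SRCQ \<phi> \<psi> P x Y z \<longleftrightarrow> (\<forall>w\<in>U. adjoint L w = 0 \<longrightarrow> (\<forall>v\<in>critical_tangents. w \<bullet> v \<le> 0) \<longrightarrow> w = 0)"
proof -
  let ?R = "range L + critical_tangents"
  have S: "SRCQ \<phi> \<psi> P x Y z \<longleftrightarrow> ?R = U"
    by (simp add: SRCQ_def frechet_q critical_tangents_def)
  have R: "r \<in> ?R \<longleftrightarrow> (\<exists>d v. r = L d + v \<and> v \<in> critical_tangents)" for r
    by (auto simp: set_plus_def)
  have ct_U: "v \<in> U" if "v \<in> critical_tangents" for v
    using that tangent_components(1)[of "fst v" "snd v"] tangent_cone_nsd(1)[OF A]
    by (cases v) (auto simp: critical_tangents_iff)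
  have "?R \<subseteq> U"
  proof
    fix r assume "r \<in> ?R"
    then obtain d v where "r = L d + v" "v \<in> critical_tangents"
      unfolding R by blast
    then show "r \<in> U"
      using subspace_add[OF subspace_sym_Times L_U ct_U] by simp
  qed
  have ct: "0 \<in> critical_tangents" "\<And>v w. v \<in> critical_tangents \<Longrightarrow> w \<in> critical_tangents \<Longrightarrow> v + w \<in> critical_tangents"
    "\<And>v s. v \<in> critical_tangents \<Longrightarrow> 0 \<le> s \<Longrightarrow> s *\<^sub>R v \<in> critical_tangents"
    by (auto simp: critical_tangents_iff tangent_polar inner_add_right add_nonpos_nonpos mult_nonneg_nonpos simp del: inner_Pair)
  show ?thesis
  proof
    assume "SRCQ \<phi> \<psi> P x Y z"
    then have RU: "?R = U"
      by (simp add: S)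
    show "\<forall>w\<in>U. adjoint L w = 0 \<longrightarrow> (\<forall>v\<in>critical_tangents. w \<bullet> v \<le> 0) \<longrightarrow> w = 0"
    proof (intro ballI impI)
      fix w assume w: "w \<in> U" "adjoint L w = 0" "\<forall>v\<in>critical_tangents. w \<bullet> v \<le> 0"
      then obtain d v where dv: "w = L d + v" "v \<in> critical_tangents"
        using RU R by blast
      have "w \<bullet> w = w \<bullet> L d + w \<bullet> v"
        using dv(1) by (metis inner_add_right)
      also have "w \<bullet> L d = 0"
        using adjoint_works[OF L, of d w] w(2) by (simp add: inner_commute)
      finally have "w \<bullet> w \<le> 0"
        using w(3) dv(2) by simp
      then show "w = 0"
        by (metis inner_eq_zero_iff inner_ge_zero order_antisym)
    qed
  next
    assume pol: "\<forall>w\<in>U. adjoint L w = 0 \<longrightarrow> (\<forall>v\<in>critical_tangents. w \<bullet> v \<le> 0) \<longrightarrow> w = 0"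
    have "?R = U"
    proof (rule ccontr)
      assume "?R \<noteq> U"
      with \<open>?R \<subseteq> U\<close> have "?R \<subset> U"
        by blast
      moreover have "0 \<in> ?R"
        unfolding R using ct(1) linear_0[OF L] by (metis add.left_neutral)
      moreover have "r + s \<in> ?R" if rs: "r \<in> ?R" "s \<in> ?R" for r s
      proof -
        obtain d1 v1 d2 v2 where "r = L d1 + v1" "v1 \<in> critical_tangents" "s = L d2 + v2" "v2 \<in> critical_tangents"
          using rs unfolding R by blast
        then have "r + s = L (d1 + d2) + (v1 + v2)" "v1 + v2 \<in> critical_tangents"
          by (simp_all add: linear_add[OF L] ct(2))
        then show ?thesis
          unfolding R by blast
      qed
      moreover have "s *\<^sub>R r \<in> ?R" if "r \<in> ?R" "0 \<le> s" for r s
        using that unfolding R by (metis ct(3) linear_scale[OF L] scaleR_add_right)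
      ultimately obtain w where w: "w \<in> U" "w \<noteq> 0" "\<And>r. r \<in> ?R \<Longrightarrow> w \<bullet> r \<le> 0"
        using convex_cone_proper_polar[OF subspace_sym_Times] by metis
      have "w \<bullet> v \<le> 0" if "v \<in> critical_tangents" for v
        using w(3)[of v] that unfolding R by (metis add.left_neutral linear_0[OF L])
      moreover have "adjoint L w = 0"
      proof -
        have "L (adjoint L w) \<in> ?R"
          unfolding R using ct(1) by (metis add.right_neutral)
        then have "w \<bullet> L (adjoint L w) \<le> 0"
          by (rule w(3))
        then have "adjoint L w \<bullet> adjoint L w \<le> 0"
          using adjoint_works[OF L, of "adjoint L w" w] by (simp add: inner_commute)
        then show ?thesis
          by (metis inner_eq_zero_iff inner_ge_zero order_antisym)
      qed
      ultimately show False
        using pol w(1,2) by blast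
    qed
    then show "SRCQ \<phi> \<psi> P x Y z"
      by (simp add: S)
  qed
qed

definition curvature :: "real^'p^'p \<Rightarrow> 'x \<Rightarrow> real" where
  "curvature y d = d \<bullet> D d + 2 * (y \<bullet> (fst (L d) ** M ** fst (L d)))"

lemma SOSC_iff:
  "SOSC f \<phi> \<psi> P x \<longleftrightarrow>
     (\<forall>d. L d \<in> critical_tangents \<longrightarrow> d \<noteq> 0 \<longrightarrow> (\<exists>(y, w)\<in>multipliers f \<phi> \<psi> P x. 0 < curvature y d))"
  unfolding SOSC_def critical_cone_iff[symmetric]
  by (auto simp: less_SUP_iff hess_lagrangian_eq frechet_phi M_def[symmetric] curvature_def split_beta
      zero_ereal_def)

text \<open>The difference of two multipliers is annihilated by \<open>adjoint L\<close> and is polar to the critical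
  directions.\<close>

lemma SRCQ_unique_multiplier:
  assumes "SRCQ \<phi> \<psi> P x Y z" and b': "b' \<in> multipliers f \<phi> \<psi> P x"
  shows "b' = (Y, z)"
proof -
  let ?w = "b' - (Y, z)"
  note b' = b'[unfolded multipliers_iff]
  have "?w \<in> U"
    using b' KKT_conditions by (intro subspace_diff subspace_sym_Times) auto
  moreover have "adjoint L ?w = 0"
    using b' KKT_conditions(2) unfolding linear_diff[OF adjoint_linear[OF L]] by (metis add_left_cancel diff_self)
  moreover have "?w \<bullet> v \<le> 0" if "v \<in> critical_tangents" for v
    using that b' by (simp add: critical_tangents_iff tangent_polar inner_diff_left del: inner_Pair)
  ultimately have "?w = 0"
    by (intro assms(1)[unfolded SRCQ_iff, rule_format])
  then show ?thesis by simp
qed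

text \<open>A nonzero \<open>w\<close> violating the dual form of the constraint qualification is a limit of vectors
  \<open>s *\<^sub>R (n - (Y, z))\<close> with \<open>n\<close> normal. Moving the multiplier from \<open>(Y, z)\<close> towards such an \<open>n\<close> keeps it normal,
  so the residual is just \<open>t *\<^sub>R adjoint L (n - (Y, z))\<close>, which is small because \<open>adjoint L w = 0\<close>.\<close>

lemma isolated_calm_imp_SRCQ:
  assumes "isolated_calm (KKT_inverse f \<phi> \<psi> P) 0 (x, Y, z)"
  shows "SRCQ \<phi> \<psi> P x Y z"
  unfolding SRCQ_iff
proof (intro ballI impI)
  fix w assume w: "w \<in> U" "adjoint L w = 0" "\<forall>v\<in>critical_tangents. w \<bullet> v \<le> 0"
  obtain \<eta> where "0 < \<eta>" and flat:
    "\<And>D \<tau>. 0 < \<tau> \<Longrightarrow> (\<And>t. 0 < t \<Longrightarrow> t < \<tau> \<Longrightarrow> (x, Y, z) + t *\<^sub>R D \<in> UNIV \<times> U \<and>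
       norm (KKT_map f \<phi> \<psi> P ((x, Y, z) + t *\<^sub>R D)) \<le> \<eta> * norm (t *\<^sub>R D)) \<Longrightarrow> D = 0"
    using isolated_calm_no_flat_ray[OF assms[unfolded KKT_inverse_eq]] by blast
  let ?N = "normal_cone K (q x) \<inter> U"
  have "w \<in> tangent_cone ?N (Y, z)"
    using w(3) by (intro polar_critical_cone_subset_tangent_normal_cone K(1) constr_set_subset subspace_sym_Times KKT_conditions(1,3) w(1))
      (simp add: critical_tangents_iff)
  then have w_cl: "w \<in> closure (cone hull ((\<lambda>n. n - (Y, z)) ` ?N))"
    using KKT_conditions(1,3) by (simp add: tangent_cone_def)
  show "w = 0"
  proof (rule ccontr)
    assume "w \<noteq> 0"
    have bl: "bounded_linear (adjoint L)"
      using adjoint_linear[OF L] by (simp add: linear_conv_bounded_linear)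
    \<comment> \<open>The strict inequality holds at \<open>w\<close> and defines an open set, so it holds at some \<open>s *\<^sub>R (n - (Y, z))\<close>
      near \<open>w\<close>; being homogeneous, it then holds at \<open>n - (Y, z)\<close>.\<close>
    have "open {m. norm (adjoint L m) < \<eta> * norm m}"
      by (intro open_Collect_less continuous_intros linear_continuous_on bl)
    moreover have "w \<in> {m. norm (adjoint L m) < \<eta> * norm m}"
      using w(2) \<open>w \<noteq> 0\<close> \<open>0 < \<eta>\<close> by simp
    ultimately obtain m where m: "m \<in> cone hull ((\<lambda>n. n - (Y, z)) ` ?N)" "norm (adjoint L m) < \<eta> * norm m"
      using w_cl unfolding closure_iff_nhds_not_empty by blast
    then obtain s n where n: "n \<in> ?N" "0 \<le> s" "m = s *\<^sub>R (n - (Y, z))"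
      by (auto simp: cone_hull_expl)
    define e where "e = n - (Y, z)"
    have "s * norm (adjoint L e) < s * (\<eta> * norm e)"
      using m(2) n(2) by (simp add: n(3) e_def[symmetric] linear_scale[OF adjoint_linear[OF L]] mult.left_commute)
    then have e: "norm (adjoint L e) < \<eta> * norm e"
      using n(2) by (simp add: mult_less_cancel_left)
    have "(0, e) = (0 :: 'x \<times> (real^'p^'p) \<times> 'z)"
    proof (rule flat[of 1])
      fix t :: real assume t: "0 < t" "t < 1"
      have "(Y, z) + t *\<^sub>R e \<in> normal_cone K (q x)"
        using n(1) KKT_conditions(3) t unfolding e_def by (intro normal_cone_between) auto
      then have "closest_point K (q x + ((Y, z) + t *\<^sub>R e)) = q x"
        by (rule closest_point_add_normal[OF K])
      moreover have "g x + adjoint L ((Y, z) + t *\<^sub>R e) = t *\<^sub>R adjoint L e"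
        using KKT_conditions(2) by (simp add: linear_add[OF adjoint_linear[OF L]]
            linear_scale[OF adjoint_linear[OF L]] add.assoc[symmetric] del: add_Pair scaleR_Pair)
      ultimately have "KKT_map f \<phi> \<psi> P (x, (Y, z) + t *\<^sub>R e) = (t *\<^sub>R adjoint L e, 0)"
        unfolding KKT_map_eq by simp
      moreover have "(x, Y, z) + t *\<^sub>R (0, e) = (x, (Y, z) + t *\<^sub>R e)"
        by (cases e) simp
      moreover have "(Y, z) + t *\<^sub>R e \<in> U"
        using n(1) KKT_conditions(1) unfolding e_def
        by (intro subspace_add subspace_scale subspace_diff subspace_sym_Times) auto
      ultimately show "(x, Y, z) + t *\<^sub>R (0, e) \<in> UNIV \<times> U \<and>
          norm (KKT_map f \<phi> \<psi> P ((x, Y, z) + t *\<^sub>R (0, e))) \<le> \<eta> * norm (t *\<^sub>R (0 :: 'x, e))"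
        using e t by (simp add: norm_Pair mult.left_commute)
    qed simp
    then show False
      using e by (simp add: zero_prod_def linear_0[OF adjoint_linear[OF L]])
  qed
qed

text \<open>Along a critical direction \<open>H\<close> with \<open>Y ** H = 0\<close> the multiplier stays normal at points of \<open>K\<close> that
  follow the ray up to an arbitrarily small linear error. For the polyhedral component the ray itself
  is feasible. For the matrix component, feasible directions approximating \<open>H\<close> are compressed to the
  kernel of \<open>Y\<close>, which preserves negative semidefiniteness, restores complementarity with \<open>Y\<close>, and
  leaves \<open>A\<close> and \<open>H\<close> fixed.\<close>

lemma flat_direction_feasible:
  assumes d: "L d \<in> critical_tangents" "Y ** fst (L d) = 0" and "0 < \<epsilon>"
  obtains \<tau> where "0 < \<tau>"
    "\<And>t. 0 < t \<Longrightarrow> t < \<tau> \<Longrightarrow> \<exists>a. (Y, z) \<in> normal_cone K a \<and> norm (a - q (x + t *\<^sub>R d)) \<le> \<epsilon> * t"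
proof -
  obtain H h where Ld: "L d = (H, h)"
    by (cases "L d")
  have T: "H \<in> tangent_cone nsd_mats (\<phi> x)" "h \<in> tangent_cone P (\<psi> x)"
    using d(1) by (auto simp: critical_tangents_iff Ld intro: tangent_components)
  have YH: "Y ** H = 0"
    using d(2) by (simp add: Ld)
  then have "Y \<bullet> H = 0"
    by (simp add: inner_eq_trace sym trace_def)
  then have zh: "z \<bullet> h = 0"
    using d(1) by (simp add: critical_tangents_iff Ld)
  obtain e r where er: "0 < e" "0 < r" "\<And>p s. p \<in> P \<Longrightarrow> dist p (\<psi> x) < r \<Longrightarrow> 0 < s \<Longrightarrow> s < e \<Longrightarrow> p + s *\<^sub>R h \<in> P"
    using polyhedron_tangent_feasible[OF P q_x(3) T(2)] by metis
  define N where "N = pinv Y"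
  \<comment> \<open>The orthogonal projection onto the kernel of \<open>Y\<close>.\<close>
  define E where "E = mat 1 - Y ** N"
  have N: "Y ** N ** Y = Y" "Y ** N = N ** Y" "transpose N = N"
    using pinv_sym[OF psd_sym[OF Y]] by (simp_all add: N_def penrose_inverse_def sym_matsD)
  have Es: "transpose E = E"
    using N by (simp add: E_def linear_diff[OF linear_transpose] matrix_transpose_mul sym)
  have YE: "Y ** E = 0"
    using N by (simp add: E_def mat_mult.diff_right) (metis matrix_mul_assoc)
  have fix_E: "E ** X ** E = X" if "Y ** X = 0" "transpose X = X" for X
  proof -
    have XY: "X ** Y = 0"
      using that by (metis matrix_transpose_mul sym(2) transpose_iff mat_mult.zero_left)
    have "E ** X = X"
      by (simp add: E_def N(2) mat_mult.diff_left that(1) flip: matrix_mul_assoc)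
    moreover have "X ** E = X"
      by (simp add: E_def mat_mult.diff_right matrix_mul_assoc XY)
    ultimately show ?thesis by simp
  qed
  have EHE: "E ** H ** E = H"
    using YH sym_matsD[OF tangent_cone_nsd(1)[OF A T(1)]] by (rule fix_E)
  have EAE: "E ** \<phi> x ** E = \<phi> x"
    using YA sym(1) by (rule fix_E)
  have "H \<in> closure (cone hull ((\<lambda>k. k - \<phi> x) ` nsd_mats))"
    using T(1) A by (simp add: tangent_cone_def)
  moreover have "open {m. norm (E ** m ** E - H) < \<epsilon>}"
  proof -
    have "bounded_linear (\<lambda>m. E ** m ** E)"
      by (rule bounded_linear_compose[OF mat_mult.bounded_linear_left mat_mult.bounded_linear_right])
    then show ?thesis
      by (intro open_Collect_less continuous_intros linear_continuous_on)
  qed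
  moreover have "H \<in> {m. norm (E ** m ** E - H) < \<epsilon>}"
    using assms(3) by (simp add: EHE)
  ultimately obtain m where "m \<in> cone hull ((\<lambda>k. k - \<phi> x) ` nsd_mats)" "norm (E ** m ** E - H) < \<epsilon>"
    unfolding closure_iff_nhds_not_empty by blast
  then obtain s k where k: "k \<in> nsd_mats" "0 \<le> s" "norm (E ** (s *\<^sub>R (k - \<phi> x)) ** E - H) < \<epsilon>"
    by (auto simp: cone_hull_expl)
  define k' where "k' = E ** k ** E"
  have k': "k' \<in> nsd_mats" "Y ** k' = 0"
    using psd_congruence[of "- k" E] k(1) YE
    by (simp_all add: k'_def Es nsd_mats_iff mat_mult.minus_left mat_mult.minus_right matrix_mul_assoc)
  have k'_H: "norm (s *\<^sub>R (k' - \<phi> x) - H) < \<epsilon>"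
    using k(3) by (simp add: k'_def EAE mat_mult.scaleR_left mat_mult.scaleR_right mat_mult.diff_left mat_mult.diff_right)
  show ?thesis
  proof (rule that)
    show "0 < min e (1 / (s + 1))"
      using er(1) k(2) by simp
    fix t assume t: "0 < t" "t < min e (1 / (s + 1))"
    then have "t * (s + 1) < 1"
      using k(2) by (simp add: pos_less_divide_eq)
    then have ts: "0 \<le> t * s" "t * s \<le> 1"
      using t(1) k(2) by (simp_all add: algebra_simps)
    define a where "a = \<phi> x + (t * s) *\<^sub>R (k' - \<phi> x)"
    have "a = (1 - t * s) *\<^sub>R \<phi> x + (t * s) *\<^sub>R k'"
      by (simp add: a_def algebra_simps)
    then have "a \<in> nsd_mats"
      using convexD_alt[OF convex_nsd A k'(1) ts] by simp
    moreover have "Y ** a = 0"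
      by (simp add: a_def mat_mult.add_right mat_mult.scaleR_right mat_mult.diff_right YA k'(2))
    ultimately have Ya: "Y \<in> normal_cone nsd_mats a"
      using Y by (simp add: normal_cone_nsd psd_sym)
    have "\<psi> x + t *\<^sub>R h \<in> P"
      using er t q_x(3) by (intro er(3)) auto
    then have "z \<in> normal_cone P (\<psi> x + t *\<^sub>R h)"
      using component_normals(3) zh by (simp add: in_normal_cone inner_diff_right inner_add_right)
    with Ya have "(Y, z) \<in> normal_cone K (a, \<psi> x + t *\<^sub>R h)"
      by (simp add: constr_set_def normal_cone_Times)
    moreover have "q (x + t *\<^sub>R d) = (\<phi> x + t *\<^sub>R H, \<psi> x + t *\<^sub>R h)"
      by (simp add: q_ray Ld) (simp add: constr_map_def)
    then have "(a, \<psi> x + t *\<^sub>R h) - q (x + t *\<^sub>R d) = t *\<^sub>R (s *\<^sub>R (k' - \<phi> x) - H, 0)"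
      by (simp add: a_def scaleR_diff_right)
    then have "norm ((a, \<psi> x + t *\<^sub>R h) - q (x + t *\<^sub>R d)) \<le> \<epsilon> * t"
      using k'_H t(1) by (simp add: norm_Pair mult.commute del: scaleR_Pair)
    ultimately show "\<exists>a. (Y, z) \<in> normal_cone K a \<and> norm (a - q (x + t *\<^sub>R d)) \<le> \<epsilon> * t"
      by blast
  qed
qed

text \<open>If the second-order form at \<open>(Y, z)\<close> is not positive at \<open>d\<close>, both of its summands vanish: the first is
  nonnegative by convexity of \<open>f\<close>, the second because \<open>Y\<close> and \<open>M\<close> are positive semidefinite. Then \<open>D d = 0\<close> keeps the gradient of the Lagrangian \<open>o(t)\<close> along the ray in
  direction \<open>d\<close>, and \<open>Y ** fst (L d) = 0\<close> does the same for the complementarity residual.\<close>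

lemma isolated_calm_imp_SOSC:
  assumes "isolated_calm (KKT_inverse f \<phi> \<psi> P) 0 (x, Y, z)"
  shows "SOSC f \<phi> \<psi> P x"
  unfolding SOSC_iff
proof (intro allI impI)
  fix d assume d: "L d \<in> critical_tangents" "d \<noteq> 0"
  obtain \<eta> where "0 < \<eta>" and flat:
    "\<And>D \<tau>. 0 < \<tau> \<Longrightarrow> (\<And>t. 0 < t \<Longrightarrow> t < \<tau> \<Longrightarrow> (x, Y, z) + t *\<^sub>R D \<in> UNIV \<times> U \<and>
       norm (KKT_map f \<phi> \<psi> P ((x, Y, z) + t *\<^sub>R D)) \<le> \<eta> * norm (t *\<^sub>R D)) \<Longrightarrow> D = 0"
    using isolated_calm_no_flat_ray[OF assms[unfolded KKT_inverse_eq]] by blast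
  obtain H h where Ld: "L d = (H, h)"
    by (cases "L d")
  have T: "H \<in> tangent_cone nsd_mats (\<phi> x)" "h \<in> tangent_cone P (\<psi> x)"
    using d(1) by (auto simp: critical_tangents_iff Ld intro: tangent_components)
  have "Y \<bullet> H \<le> 0" "z \<bullet> h \<le> 0"
    using T component_normals(2,3) A q_x(3)
    by (simp_all add: tangent_cone_iff_polar convex_nsd polyhedron_imp_convex P)
  then have YH: "Y \<bullet> H = 0"
    using d(1) by (simp add: critical_tangents_iff Ld)
  have "0 < curvature Y d"
  proof (rule ccontr)
    assume "\<not> 0 < curvature Y d"
    moreover have "0 \<le> d \<bullet> D d" "0 \<le> Y \<bullet> (H ** M ** H)"
      using convex_hessian_nonneg[OF f g D] curvature_nonneg[OF tangent_cone_nsd(1)[OF A T(1)]] by auto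
    ultimately have "d \<bullet> D d = 0" "Y \<bullet> (H ** M ** H) = 0"
      by (simp_all add: curvature_def Ld)
    then have Dd: "D d = 0" and "Y ** H = 0"
      using convex_hessian_kernel[OF f g D] flat_critical_direction[OF T(1) YH] by auto
    then have YLd: "Y ** fst (L d) = 0"
      by (simp add: Ld)
    \<comment> \<open>Half of the allowed residual goes to stationarity and half to complementarity, where the
      projection bound costs a further factor of two.\<close>
    define \<epsilon> where "\<epsilon> = \<eta> * norm d / 4"
    have "0 < \<epsilon>"
      using \<open>0 < \<eta>\<close> d(2) by (simp add: \<epsilon>_def)
    obtain \<tau>1 where \<tau>1: "0 < \<tau>1" "\<And>t. 0 < t \<Longrightarrow> t < \<tau>1 \<Longrightarrow>
        \<exists>a. (Y, z) \<in> normal_cone K a \<and> norm (a - q (x + t *\<^sub>R d)) \<le> \<epsilon> * t"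
      using flat_direction_feasible[OF d(1) YLd \<open>0 < \<epsilon>\<close>] by metis
    obtain r where r: "0 < r" "\<And>v. norm (v - x) < r \<Longrightarrow> norm (g v - g x - D (v - x)) \<le> (\<eta> / 2) * norm (v - x)"
      using D \<open>0 < \<eta>\<close> unfolding has_derivative_at_alt by (metis half_gt_zero)
    have "(d, 0) = (0 :: 'x \<times> (real^'p^'p) \<times> 'z)"
    proof (rule flat)
      show "0 < min \<tau>1 (r / norm d)"
        using \<tau>1(1) r(1) d(2) by simp
      fix t :: real assume t: "0 < t" "t < min \<tau>1 (r / norm d)"
      have "t * norm d < r"
        using t d(2) by (simp add: pos_less_divide_eq)
      then have "norm (g (x + t *\<^sub>R d) - g x) \<le> (\<eta> / 2) * (t * norm d)"
        using r(2)[of "x + t *\<^sub>R d"] t(1) Dd linear_scale[OF has_derivative_linear[OF D]] by simp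
      moreover have "g (x + t *\<^sub>R d) + adjoint L (Y, z) = g (x + t *\<^sub>R d) - g x"
        using KKT_conditions(2) by (simp add: eq_neg_iff_add_eq_0[symmetric] add.commute)
      ultimately have 1: "norm (g (x + t *\<^sub>R d) + adjoint L (Y, z)) \<le> (\<eta> / 2) * (t * norm d)"
        by simp
      obtain a where a: "(Y, z) \<in> normal_cone K a" "norm (a - q (x + t *\<^sub>R d)) \<le> \<epsilon> * t"
        using \<tau>1(2)[of t] t by auto
      have 2: "norm (- q (x + t *\<^sub>R d) + closest_point K (q (x + t *\<^sub>R d) + (Y, z))) \<le> (\<eta> / 2) * (t * norm d)"
        using projection_residual_le[OF K a(1), of "q (x + t *\<^sub>R d)"] a(2) by (simp add: \<epsilon>_def algebra_simps)
      have "norm (KKT_map f \<phi> \<psi> P (x + t *\<^sub>R d, Y, z)) \<le> \<eta> * (t * norm d)"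
        unfolding KKT_map_eq using norm_Pair_le[of "g (x + t *\<^sub>R d) + adjoint L (Y, z)"] 1 2
        by (smt (verit) field_sum_of_halves distrib_right)
      then show "(x, Y, z) + t *\<^sub>R (d, 0) \<in> UNIV \<times> U \<and>
          norm (KKT_map f \<phi> \<psi> P ((x, Y, z) + t *\<^sub>R (d, 0))) \<le> \<eta> * norm (t *\<^sub>R (d, 0 :: (real^'p^'p) \<times> 'z))"
        using KKT_conditions(1) t(1) by (simp add: zero_prod_def norm_Pair)
    qed
    then show False
      using d(2) by (simp add: zero_prod_def)
  qed
  then show "\<exists>(y, w)\<in>multipliers f \<phi> \<psi> P x. 0 < curvature y d"
    using mult by blast
qed

text \<open>With \<open>a\<close> the projection of \<open>q X + B\<close> and \<open>r = a - q X\<close> the second residual, \<open>B - r\<close> is an exact normal at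
  \<open>a\<close>. Residuals vanish faster than the displacement, so the pairs \<open>(a, B - r)\<close> and \<open>(q X, B)\<close> have the
  same first-order behaviour, and the first residual yields the linearised stationarity equation.\<close>

lemma not_isolated_calm_tangent:
  assumes "\<not> isolated_calm (KKT_inverse f \<phi> \<psi> P) 0 (x, Y, z)"
  obtains d w where "(d, w) \<noteq> 0" "w \<in> U" "D d + adjoint L w = 0"
    "normal_graph_tangent U K (q x) (Y, z) (L d) w"
proof -
  have "(x, Y, z) \<in> UNIV \<times> U" "KKT_map f \<phi> \<psi> P (x, Y, z) = 0"
    using KKT_conditions by (simp_all add: KKT_map_eq closest_point_add_normal[OF K] zero_prod_def)
  from not_isolated_calm_direction[of "(x, Y, z)" "UNIV \<times> U" "KKT_map f \<phi> \<psi> P", OF this assms[unfolded KKT_inverse_eq]]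
  obtain t :: "nat \<Rightarrow> real" and V E where t: "\<And>n. 0 < t n" "t \<longlonglongrightarrow> 0" and V: "\<And>n. V n \<in> UNIV \<times> U"
    and "norm E = 1" and E: "(\<lambda>n. (1 / t n) *\<^sub>R (V n - (x, Y, z))) \<longlonglongrightarrow> E"
    and G: "(\<lambda>n. (1 / t n) *\<^sub>R KKT_map f \<phi> \<psi> P (V n)) \<longlonglongrightarrow> 0"
    by blast
  define X B where "X n = fst (V n)" and "B n = snd (V n)" for n
  define a where "a n = closest_point K (q (X n) + B n)" for n
  define r where "r n = - q (X n) + a n" for n
  have KV: "KKT_map f \<phi> \<psi> P (V n) = (g (X n) + adjoint L (B n), r n)" for n
    using KKT_map_eq[of "X n" "B n"] by (simp add: X_def B_def r_def a_def)
  have BU: "B n \<in> U" for n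
    using V[of n] by (simp add: B_def mem_Times_iff)
  have Xd: "(\<lambda>n. (1 / t n) *\<^sub>R (X n - x)) \<longlonglongrightarrow> fst E"
    using tendsto_fst[OF E] by (simp add: X_def)
  have Bw: "(\<lambda>n. (1 / t n) *\<^sub>R (B n - (Y, z))) \<longlonglongrightarrow> snd E"
    using tendsto_snd[OF E] by (simp add: B_def)
  have r0: "(\<lambda>n. (1 / t n) *\<^sub>R r n) \<longlonglongrightarrow> 0"
    using tendsto_snd[OF G] by (simp add: KV)
  have aK: "a n \<in> K" for n
    using closest_point_in_set[OF K(2), of "q (X n) + B n"] q_x(1) by (auto simp: a_def)
  have rU: "r n \<in> U" for n
    using aK[of n] constr_set_subset q_U unfolding r_def
    by (intro subspace_add subspace_neg subspace_sym_Times) auto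
  have nc: "B n - r n \<in> normal_cone K (a n)" for n
    using diff_closest_point_normal[OF K, of "q (X n) + B n"] q_x(1) by (auto simp: a_def r_def algebra_simps)
  have bl: "bounded_linear L" "bounded_linear (adjoint L)"
    using L adjoint_linear[OF L] by (simp_all add: linear_conv_bounded_linear)
  have "normal_graph_tangent U K (q x) (Y, z) (L (fst E)) (snd E)"
    unfolding normal_graph_tangent_def
  proof (rule exI[of _ t], rule exI[of _ a], rule exI[of _ "\<lambda>n. B n - r n"], intro conjI allI t nc)
    show "B n - r n \<in> U" for n
      by (intro subspace_diff subspace_sym_Times BU rU)
    have "(\<lambda>n. (1 / t n) *\<^sub>R r n + L ((1 / t n) *\<^sub>R (X n - x))) \<longlonglongrightarrow> 0 + L (fst E)"
      by (intro tendsto_add r0 bounded_linear.tendsto[OF bl(1)] Xd)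
    moreover have "(1 / t n) *\<^sub>R r n + L ((1 / t n) *\<^sub>R (X n - x)) = (1 / t n) *\<^sub>R (a n - q x)" for n
      by (simp only: linear_scale[OF L] L_diff scaleR_add_right[symmetric]) (simp add: r_def)
    ultimately show "(\<lambda>n. (1 / t n) *\<^sub>R (a n - q x)) \<longlonglongrightarrow> L (fst E)"
      by simp
    have "(\<lambda>n. (1 / t n) *\<^sub>R (B n - (Y, z)) - (1 / t n) *\<^sub>R r n) \<longlonglongrightarrow> snd E - 0"
      by (intro tendsto_diff r0 Bw)
    moreover have "(1 / t n) *\<^sub>R (B n - (Y, z)) - (1 / t n) *\<^sub>R r n = (1 / t n) *\<^sub>R (B n - r n - (Y, z))" for n
      by (simp only: scaleR_diff_right[symmetric]) (simp add: algebra_simps)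
    ultimately show "(\<lambda>n. (1 / t n) *\<^sub>R (B n - r n - (Y, z))) \<longlonglongrightarrow> snd E"
      by simp
  qed
  moreover have "D (fst E) + adjoint L (snd E) = 0"
  proof -
    have "(\<lambda>n. (1 / t n) *\<^sub>R (g (X n) - g x) + adjoint L ((1 / t n) *\<^sub>R (B n - (Y, z))))
        \<longlonglongrightarrow> D (fst E) + adjoint L (snd E)"
      by (intro tendsto_add has_derivative_difference_quotient[OF D t Xd] bounded_linear.tendsto[OF bl(2)] Bw)
    moreover have "(1 / t n) *\<^sub>R (g (X n) - g x) + adjoint L ((1 / t n) *\<^sub>R (B n - (Y, z))) =
        (1 / t n) *\<^sub>R (g (X n) + adjoint L (B n))" for n
    proof -
      have "g (X n) - g x + (adjoint L (B n) - adjoint L (Y, z)) = g (X n) + adjoint L (B n)"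
        using KKT_conditions(2) by (metis (no_types, lifting) add_diff_add diff_zero)
      then show ?thesis
        by (simp only: linear_scale[OF adjoint_linear[OF L]] linear_diff[OF adjoint_linear[OF L]]
            scaleR_add_right[symmetric])
    qed
    ultimately have "(\<lambda>n. (1 / t n) *\<^sub>R (g (X n) + adjoint L (B n))) \<longlonglongrightarrow> D (fst E) + adjoint L (snd E)"
      by simp
    moreover have "(\<lambda>n. (1 / t n) *\<^sub>R (g (X n) + adjoint L (B n))) \<longlonglongrightarrow> 0"
      using tendsto_fst[OF G] by (simp add: KV)
    ultimately show ?thesis
      by (rule LIMSEQ_unique)
  qed
  moreover have "snd E \<in> U"
  proof (rule Lim_in_closed_set[OF closed_subspace[OF subspace_sym_Times] _ _ Bw])
    show "\<forall>\<^sub>F n in sequentially. (1 / t n) *\<^sub>R (B n - (Y, z)) \<in> U"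
      using BU KKT_conditions(1) by (intro always_eventually allI subspace_scale subspace_diff subspace_sym_Times)
  qed simp
  moreover have "(fst E, snd E) \<noteq> 0"
    using \<open>norm E = 1\<close> by auto
  ultimately show ?thesis
    by (intro that[of "fst E" "snd E"])
qed

text \<open>Pairing the linearised stationarity equation with \<open>d\<close> shows that the second-order form is nonpositive
  at \<open>d\<close>, whence \<open>d = 0\<close>; what remains of the tangent direction is excluded by the dual form of the
  constraint qualification.\<close>

lemma SOSC_SRCQ_imp_isolated_calm:
  assumes sosc: "SOSC f \<phi> \<psi> P x" and srcq: "SRCQ \<phi> \<psi> P x Y z"
  shows "isolated_calm (KKT_inverse f \<phi> \<psi> P) 0 (x, Y, z)"
proof (rule ccontr)
  assume "\<not> ?thesis"
  then obtain d w where dw: "(d, w) \<noteq> 0" and w: "w \<in> U" and stat: "D d + adjoint L w = 0"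
    and tan: "normal_graph_tangent U K (q x) (Y, z) (L d) w"
    by (rule not_isolated_calm_tangent)
  have crit: "L d \<in> critical_tangents"
    using normal_graph_tangentD[OF K(1) KKT_conditions(3) tan] by (simp add: critical_tangents_iff)
  obtain H h W v where Ld: "L d = (H, h)" and wW: "w = (W, v)"
    by (cases "L d", cases w)
  have tanS: "normal_graph_tangent sym_mats nsd_mats (\<phi> x) Y H W"
    and tanP: "normal_graph_tangent UNIV P (\<psi> x) z h v"
    using normal_graph_tangent_Times[of sym_mats UNIV nsd_mats P "\<phi> x" "\<psi> x" Y z H h W v] tan
    by (simp_all add: Ld wW constr_set_def constr_map_def)
  have "d \<bullet> D d + L d \<bullet> w = 0"
    using stat adjoint_works[OF L, of d w] by (metis inner_add_right inner_zero_right)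
  moreover have "0 \<le> h \<bullet> v"
    by (rule normal_graph_tangentD(3)[OF polyhedron_imp_convex[OF P] component_normals(3) tanP])
  ultimately have "curvature Y d \<le> 0"
    using normal_graph_tangent_curvature[OF tanS] by (simp add: curvature_def Ld wW)
  moreover have "0 < curvature Y d" if "d \<noteq> 0"
    using sosc crit that SRCQ_unique_multiplier[OF srcq] unfolding SOSC_iff by blast
  ultimately have "d = 0"
    by fastforce
  then have H0: "H = 0" "h = 0" and "adjoint L w = 0"
    using Ld stat linear_0[OF L] linear_0[OF has_derivative_linear[OF D]] by (auto simp: zero_prod_def)
  have "w \<bullet> u \<le> 0" if "u \<in> critical_tangents" for u
  proof -
    obtain V p where u: "u = (V, p)"
      by (cases u)
    have T: "V \<in> tangent_cone nsd_mats (\<phi> x)" "p \<in> tangent_cone P (\<psi> x)"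
      using that by (auto simp: critical_tangents_iff u intro: tangent_components)
    have "Y \<bullet> V \<le> 0" "z \<bullet> p \<le> 0"
      using T component_normals(2,3) A q_x(3)
      by (simp_all add: tangent_cone_iff_polar convex_nsd polyhedron_imp_convex P)
    then have "Y \<bullet> V = 0" "z \<bullet> p = 0"
      using that by (simp_all add: critical_tangents_iff u)
    then have "W \<bullet> V \<le> 0" "v \<bullet> p \<le> 0"
      using vertical_normal_graph_tangent[OF tanS[unfolded H0] T(1)]
        polyhedron_normal_graph_tangent[OF P component_normals(3) tanP T(2)] by auto
    then show ?thesis
      by (simp add: u wW)
  qed
  then have "w = 0"
    using srcq w \<open>adjoint L w = 0\<close> unfolding SRCQ_iff by blast
  then show False
    using dw \<open>d = 0\<close> by (simp add: zero_prod_def)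
qed

end

text \<open>The Riesz representation of the first derivative, in coordinates so that it can be differentiated
  termwise.\<close>

lemma twice_continuously_differentiable_gradient:
  fixes f :: "'x::euclidean_space \<Rightarrow> real"
  assumes "twice_continuously_differentiable f"
  obtains g D where "\<And>x. (f has_derivative (\<lambda>h. g x \<bullet> h)) (at x)" "\<And>x. (g has_derivative D x) (at x)"
proof -
  obtain f' :: "'x \<Rightarrow> 'x \<Rightarrow>\<^sub>L real" and f'' where
    f': "\<And>x. (f has_derivative blinfun_apply (f' x)) (at x)" and
    f'': "\<And>x. (f' has_derivative blinfun_apply (f'' x)) (at x)"
    using assms unfolding twice_continuously_differentiable_def by blast
  let ?g = "\<lambda>x. \<Sum>b\<in>Basis. blinfun_apply (f' x) b *\<^sub>R b"
  have eq: "blinfun_apply (f' x) = (\<lambda>h. ?g x \<bullet> h)" for x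
  proof
    fix h
    have "blinfun_apply (f' x) h = blinfun_apply (f' x) (\<Sum>b\<in>Basis. (h \<bullet> b) *\<^sub>R b)"
      by (simp add: euclidean_representation)
    also have "\<dots> = ?g x \<bullet> h"
      by (simp add: blinfun.sum_right blinfun.scaleR_right inner_sum_left inner_commute[of h] mult.commute)
    finally show "blinfun_apply (f' x) h = ?g x \<bullet> h" .
  qed
  show ?thesis
  proof (rule that)
    show "(f has_derivative (\<lambda>h. ?g x \<bullet> h)) (at x)" for x
      using has_derivative_eq_rhs[OF f' eq] .
    show "(?g has_derivative (\<lambda>h. \<Sum>b\<in>Basis. blinfun_apply (blinfun_apply (f'' x) h) b *\<^sub>R b)) (at x)" for x
      by (intro has_derivative_sum has_derivative_scaleR_left bounded_linear.has_derivative[OF blinfun.bounded_linear_left] f'')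
  qed
qed

theorem corollary4p1:
  fixes f :: "'x::euclidean_space \<Rightarrow> real"
    and \<phi> :: "'x \<Rightarrow> real^'p^'p"
    and \<psi> :: "'x \<Rightarrow> 'z::euclidean_space"
    and P :: "'z set"
    and xbar :: 'x and ybar :: "real^'p^'p" and zbar :: 'z
  assumes "\<forall>x. \<phi> x \<in> sym_mats"
    and "polyhedron P" and "P \<noteq> {}"
    and "twice_continuously_differentiable f" and "convex_on UNIV f"
    and "affine_mapping (constr_map \<phi> \<psi>)"
    and "is_arg_min f (\<lambda>x. constr_map \<phi> \<psi> x \<in> constr_set P) xbar"
    and "multipliers f \<phi> \<psi> P xbar \<noteq> {}"
    and "(ybar, zbar) \<in> multipliers f \<phi> \<psi> P xbar"
  shows "isolated_calm (KKT_inverse f \<phi> \<psi> P) 0 (xbar, ybar, zbar) \<longleftrightarrow>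
         SOSC f \<phi> \<psi> P xbar \<and> SRCQ \<phi> \<psi> P xbar ybar zbar"
proof -
  obtain g D where g: "\<And>x. (f has_derivative (\<lambda>h. g x \<bullet> h)) (at x)" and D: "\<And>x. (g has_derivative D x) (at x)"
    using twice_continuously_differentiable_gradient[OF assms(4)] by metis
  obtain L c where "linear L" "constr_map \<phi> \<psi> = (\<lambda>x. L x + c)"
    using assms(6) unfolding affine_mapping_def by blast
  then interpret affine_convex_problem f \<phi> \<psi> P xbar ybar zbar g "D xbar" L c
    using assms(1,2,5,9) g D by (intro affine_convex_problem.intro) auto
  show ?thesis
    using isolated_calm_imp_SRCQ isolated_calm_imp_SOSC SOSC_SRCQ_imp_isolated_calm by blast
qed

end
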